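(* Let $\alpha\in(0,1)$ and $p\in[1,\infty]$, and assume (Mass regularity) and (Endpoint accuracy at $p$), both stated in the context. Fix $\delta\in(0,1)$ and $n,m\ge 1$ such that $$2\mu_{\rm up}\,\epsilon_p(n,\delta/4)+\eta_m(\delta)\le 2\mu_{\rm low}r_-,\qquad 2\mu_{\rm up}\,\epsilon_p(n,\delta/4)+\eta_m(\delta)+s_m\le 2\mu_{\rm low}r_+ .$$ On the event $\mathcal A_{n,m}(\delta)=\mathcal E_{\rm tr}\cap\mathcal E_{\rm DKW}$ defined in the context, whose probability is at least $1-\delta$, $$\bigl\|\mathrm{Cov}_{\hat{\mathcal C}_\alpha}(\cdot)-(1-\alpha)\bigr\|_{L^p(P_X)}\le 2\mu_{\rm up}\Bigl(1+\frac{\mu_{\rm up}}{\mu_{\rm low}}\Bigr)\epsilon_p(n,\delta/4)+\frac{\mu_{\rm up}}{\mu_{\rm low}}\bigl(\eta_m(\delta)+s_m\bigr).$$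
   Context: Generalized inverse: for a nondecreasing right-continuous $H:\mathbb R\to[0,\infty)$ with $\lim_{t\to-\infty}H(t)=0$ and $\tau>0$, $\mathrm Q(\tau;H)=\inf\{t\in\mathbb R:H(t)\ge\tau\}$, with $\inf\varnothing=+\infty$. Setup. $\mathcal X$ is a measurable space, $P_X$ a probability measure on $\mathcal X$, $x\mapsto P_{Y\mid X=x}$ a probability kernel from $\mathcal X$ to $\mathbb R$, and $P_{XY}=P_X\otimes P_{Y\mid X}$. For $\tau\in(0,1)$, $f^\star_\tau(x)=\inf\{t\in\mathbb R: P_{Y\mid X=x}((-\infty,t])\ge\tau\}$. (Mass regularity) There are constants $0<\mu_{\rm low}\le\mu_{\rm up}<\infty$, $r_0>0$ and a measurable set $\mathcal X_0$ with $P_X(\mathcal X_0)=1$ such that for every $x\in\mathcal X_0$: $P_{Y\mid X=x}([u,v])\le\mu_{\rm up}(v-u)$ for all finite $u\le v$; and for $\tau\in\{\alpha/2,1-\alpha/2\}$ and $0\le h\le r_0$, $P_{Y\mid X=x}([f^\star_\tau(x)-h,f^\star_\tau(x)])\ge\mu_{\rm low}h$ and $P_{Y\mid X=x}([f^\star_\tau(x),f^\star_\tau(x)+h])\ge\mu_{\rm low}h$. Samples. $\mathcal D^{\rm tr}_n\sim P_{XY}^{\otimes n}$ and $\mathcal D^{\rm cal}_m=\{(X_i,Y_i)\}_{i=1}^m\sim P_{XY}^{\otimes m}$ are independent. The training sample produces finite real-valued raw maps $(\mathcal D^{\rm tr}_n,x)\mapsto\widetilde f_{n,\tau}(x)$,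 jointly measurable, for $\tau\in\{\alpha/2,1-\alpha/2\}$. (Endpoint accuracy at $p$) There is $\epsilon_p:\mathbb N\times(0,1)\to[0,\infty)$ such that for every $n\in\mathbb N$, $\delta\in(0,1)$, $\tau\in\{\alpha/2,1-\alpha/2\}$: $\mathbb P_{\mathcal D^{\rm tr}_n}(\|\widetilde f_{n,\tau}-f^\star_\tau\|_{L^p(P_X)}\le\epsilon_p(n,\delta))\ge1-\delta$. Split CQR. Sorted endpoints: $\hat f_{n,\alpha/2}=\widetilde f_{n,\alpha/2}\wedge\widetilde f_{n,1-\alpha/2}$, $\hat f_{n,1-\alpha/2}=\widetilde f_{n,\alpha/2}\vee\widetilde f_{n,1-\alpha/2}$ (pointwise). Fitted score: $\widehat S(x,y)=\max\{\hat f_{n,\alpha/2}(x)-y,\;y-\hat f_{n,1-\alpha/2}(x)\}$. Empirical score CDF: $\widehat F_m(t)=\frac1m\sum_{i=1}^m\mathbf 1\{\widehat S(X_i,Y_i)\le t\}$. Level $\beta_m=\lceil(m+1)(1-\alpha)\rceil/m$, threshold $\widehat Q_{\beta_m}=\mathrm Q(\beta_m;\widehat F_m)$, prediction set $\hat{\mathcal C}_\alpha(x)=\{y\in\mathbb R:\widehat S(x,y)\le\widehat Q_{\beta_m}\}$. For fixed data, the conditional coverage profile of a set-valued rule $C$ is $\mathrm{Cov}_C(x)=P_{Y\mid X=x}(C(x))$. Scales: $s_m=\beta_m-(1-\alpha)$, $\eta_m(\delta)=\sqrt{\log(4/\delta)/(2m)}$, $r_-=r_0\wedge\frac{1-\alpha}{2\mu_{\rm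 up}}$, $r_+=r_0$. Events: $\mathcal E_{\rm tr}=\bigcap_{\tau\in\{\alpha/2,1-\alpha/2\}}\{\|\widetilde f_{n,\tau}-f^\star_\tau\|_{L^p(P_X)}\le\epsilon_p(n,\delta/4)\}$ and $\mathcal E_{\rm DKW}=\{\sup_{t\in\mathbb R}|\widehat F_m(t)-F(t)|\le\eta_m(\delta)\}$, where $F(t)=\mathbb P(\widehat S(X,Y)\le t\mid\mathcal D^{\rm tr}_n)$ for $(X,Y)\sim P_{XY}$ independent of the training sample. *)

theory Defs
  imports "HOL-Probability.Probability"
begin

text \<open>The norm of \<open>L\<^sup>p(M)\<close> for \<open>p \<in> [1,\<infinity>]\<close>, with the value \<open>\<infinity>\<close> outside \<open>L\<^sup>p(M)\<close>. The library
  has no \<open>powr\<close> on \<^typ>\<open>ennreal\<close>, hence the separate case of an infinite integral.\<close>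

definition Lp_norm :: "ennreal \<Rightarrow> 'a measure \<Rightarrow> ('a \<Rightarrow> real) \<Rightarrow> ennreal" where
  "Lp_norm p M g =
    (if p = \<infinity> then esssup M (\<lambda>x. ennreal \<bar>g x\<bar>)
     else let I = (\<integral>\<^sup>+ x. ennreal (\<bar>g x\<bar> powr enn2real p) \<partial>M)
          in if I = \<infinity> then \<infinity> else ennreal (enn2real I powr (1 / enn2real p)))"

text \<open>\<open>Inf {} = \<infinity>\<close> in \<^typ>\<open>ereal\<close>, as required when the level \<open>\<tau>\<close> is never reached.\<close>

definition gen_inverse :: "real \<Rightarrow> (real \<Rightarrow> real) \<Rightarrow> ereal" where
  "gen_inverse \<tau> H = Inf (ereal ` {t. \<tau> \<le> H t})"

definition joint_law :: "'a measure \<Rightarrow> ('a \<Rightarrow> real measure) \<Rightarrow> ('a \<times> real) measure" where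
  "joint_law PX K =
    PX \<bind> (\<lambda>x. K x \<bind> (\<lambda>y. return (PX \<Otimes>\<^sub>M borel) (x, y)))"

text \<open>Samples of size \<open>n\<close> are functions on \<open>{1..n}\<close>, extensional outside of it.\<close>

definition sample_law :: "'a measure \<Rightarrow> ('a \<Rightarrow> real measure) \<Rightarrow> nat \<Rightarrow> (nat \<Rightarrow> 'a \<times> real) measure" where
  "sample_law PX K n = Pi\<^sub>M {1..n} (\<lambda>_. joint_law PX K)"

text \<open>For \<open>0 < \<tau> < 1\<close> the set is nonempty and bounded below, so the real infimum is the true one.\<close>

definition cond_quantile :: "('a \<Rightarrow> real measure) \<Rightarrow> real \<Rightarrow> 'a \<Rightarrow> real" where
  "cond_quantile K \<tau> x = Inf {t. \<tau> \<le> cdf (K x) t}"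

definition mass_regularity ::
  "'a measure \<Rightarrow> ('a \<Rightarrow> real measure) \<Rightarrow> real \<Rightarrow> real \<Rightarrow> real \<Rightarrow> real \<Rightarrow> bool" where
  "mass_regularity PX K \<alpha> \<mu>low \<mu>up r0 \<longleftrightarrow>
    0 < \<mu>low \<and> \<mu>low \<le> \<mu>up \<and> 0 < r0 \<and>
    (\<exists>X0 \<in> sets PX. measure PX X0 = 1 \<and>
      (\<forall>x\<in>X0.
        (\<forall>u v. u \<le> v \<longrightarrow> measure (K x) {u..v} \<le> \<mu>up * (v - u)) \<and>
        (\<forall>\<tau>\<in>{\<alpha>/2, 1 - \<alpha>/2}. \<forall>h. 0 \<le> h \<and> h \<le> r0 \<longrightarrow>
          measure (K x) {cond_quantile K \<tau> x - h .. cond_quantile K \<tau> x} \<ge> \<mu>low * h \<and>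
          measure (K x) {cond_quantile K \<tau> x .. cond_quantile K \<tau> x + h} \<ge> \<mu>low * h)))"

text \<open>A training procedure \<open>f\<close> maps a sample size \<open>n\<close>, a level \<open>\<tau>\<close> and a training sample \<open>D\<close> to the raw
  map \<open>f n \<tau> D\<close>.\<close>

type_synonym 'a training = "nat \<Rightarrow> real \<Rightarrow> (nat \<Rightarrow> 'a \<times> real) \<Rightarrow> 'a \<Rightarrow> real"

definition raw_maps_measurable ::
  "'a measure \<Rightarrow> ('a \<Rightarrow> real measure) \<Rightarrow> real \<Rightarrow> 'a training \<Rightarrow> bool" where
  "raw_maps_measurable PX K \<alpha> f \<longleftrightarrow>
    (\<forall>n\<ge>1. \<forall>\<tau>\<in>{\<alpha>/2, 1 - \<alpha>/2}.
      (\<lambda>(D, x). f n \<tau> D x) \<in> borel_measurable (sample_law PX K n \<Otimes>\<^sub>M PX))"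

definition endpoint_accuracy ::
  "'a measure \<Rightarrow> ('a \<Rightarrow> real measure) \<Rightarrow> real \<Rightarrow> ennreal \<Rightarrow> 'a training \<Rightarrow> (nat \<Rightarrow> real \<Rightarrow> real) \<Rightarrow> bool" where
  "endpoint_accuracy PX K \<alpha> p f \<epsilon> \<longleftrightarrow>
    (\<forall>n\<ge>1. \<forall>\<delta>. 0 < \<delta> \<and> \<delta> < 1 \<longrightarrow>
      0 \<le> \<epsilon> n \<delta> \<and>
      (\<forall>\<tau>\<in>{\<alpha>/2, 1 - \<alpha>/2}.
        measure (sample_law PX K n)
          {D \<in> space (sample_law PX K n).
            Lp_norm p PX (\<lambda>x. f n \<tau> D x - cond_quantile K \<tau> x) \<le> ennreal (\<epsilon> n \<delta>)} \<ge> 1 - \<delta>))"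

definition lower_endpoint ::
  "real \<Rightarrow> 'a training \<Rightarrow> nat \<Rightarrow> (nat \<Rightarrow> 'a \<times> real) \<Rightarrow> 'a \<Rightarrow> real" where
  "lower_endpoint \<alpha> f n D x = min (f n (\<alpha>/2) D x) (f n (1 - \<alpha>/2) D x)"

definition upper_endpoint ::
  "real \<Rightarrow> 'a training \<Rightarrow> nat \<Rightarrow> (nat \<Rightarrow> 'a \<times> real) \<Rightarrow> 'a \<Rightarrow> real" where
  "upper_endpoint \<alpha> f n D x = max (f n (\<alpha>/2) D x) (f n (1 - \<alpha>/2) D x)"

definition fitted_score ::
  "real \<Rightarrow> 'a training \<Rightarrow> nat \<Rightarrow> (nat \<Rightarrow> 'a \<times> real) \<Rightarrow> 'a \<times> real \<Rightarrow> real" where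
  "fitted_score \<alpha> f n D =
    (\<lambda>(x, y). max (lower_endpoint \<alpha> f n D x - y) (y - upper_endpoint \<alpha> f n D x))"

definition empirical_cdf :: "nat \<Rightarrow> (nat \<Rightarrow> 'z) \<Rightarrow> ('z \<Rightarrow> real) \<Rightarrow> real \<Rightarrow> real" where
  "empirical_cdf m D S t = (1 / real m) * (\<Sum>i=1..m. of_bool (S (D i) \<le> t))"

text \<open>The score CDF given the training sample: the fitted score \<open>S\<close> is frozen and evaluated at a fresh
  draw from the joint law.\<close>

definition score_cdf ::
  "'a measure \<Rightarrow> ('a \<Rightarrow> real measure) \<Rightarrow> ('a \<times> real \<Rightarrow> real) \<Rightarrow> real \<Rightarrow> real" where
  "score_cdf PX K S t = measure (joint_law PX K) {z \<in> space (joint_law PX K). S z \<le> t}"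

definition conf_level :: "real \<Rightarrow> nat \<Rightarrow> real" where
  "conf_level \<alpha> m = of_int \<lceil>(real m + 1) * (1 - \<alpha>)\<rceil> / real m"

definition cqr_threshold ::
  "real \<Rightarrow> 'a training \<Rightarrow> nat \<Rightarrow> nat \<Rightarrow> (nat \<Rightarrow> 'a \<times> real) \<Rightarrow> (nat \<Rightarrow> 'a \<times> real) \<Rightarrow> ereal" where
  "cqr_threshold \<alpha> f n m Dtr Dcal =
    gen_inverse (conf_level \<alpha> m) (empirical_cdf m Dcal (fitted_score \<alpha> f n Dtr))"

definition cqr_set ::
  "real \<Rightarrow> 'a training \<Rightarrow> nat \<Rightarrow> nat \<Rightarrow> (nat \<Rightarrow> 'a \<times> real) \<Rightarrow> (nat \<Rightarrow> 'a \<times> real) \<Rightarrow> 'a \<Rightarrow> real set" where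
  "cqr_set \<alpha> f n m Dtr Dcal x =
    {y. ereal (fitted_score \<alpha> f n Dtr (x, y)) \<le> cqr_threshold \<alpha> f n m Dtr Dcal}"

definition cond_coverage :: "('a \<Rightarrow> real measure) \<Rightarrow> ('a \<Rightarrow> real set) \<Rightarrow> 'a \<Rightarrow> real" where
  "cond_coverage K C x = measure (K x) (C x)"

definition level_excess :: "real \<Rightarrow> nat \<Rightarrow> real" where
  "level_excess \<alpha> m = conf_level \<alpha> m - (1 - \<alpha>)"

definition dkw_radius :: "nat \<Rightarrow> real \<Rightarrow> real" where
  "dkw_radius m \<delta> = sqrt (ln (4 / \<delta>) / (2 * real m))"

definition r_minus :: "real \<Rightarrow> real \<Rightarrow> real \<Rightarrow> real" where
  "r_minus \<alpha> \<mu>up r0 = min r0 ((1 - \<alpha>) / (2 * \<mu>up))"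

definition r_plus :: "real \<Rightarrow> real" where
  "r_plus r0 = r0"

definition training_event ::
  "'w measure \<Rightarrow> 'a measure \<Rightarrow> ('a \<Rightarrow> real measure) \<Rightarrow> real \<Rightarrow> ennreal \<Rightarrow> 'a training \<Rightarrow>
    (nat \<Rightarrow> real \<Rightarrow> real) \<Rightarrow> nat \<Rightarrow> real \<Rightarrow> ('w \<Rightarrow> nat \<Rightarrow> 'a \<times> real) \<Rightarrow> 'w set" where
  "training_event M PX K \<alpha> p f \<epsilon> n \<delta> Dtr =
    {\<omega> \<in> space M. \<forall>\<tau>\<in>{\<alpha>/2, 1 - \<alpha>/2}.
      Lp_norm p PX (\<lambda>x. f n \<tau> (Dtr \<omega>) x - cond_quantile K \<tau> x) \<le> ennreal (\<epsilon> n (\<delta>/4))}"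

definition dkw_event ::
  "'w measure \<Rightarrow> 'a measure \<Rightarrow> ('a \<Rightarrow> real measure) \<Rightarrow> real \<Rightarrow> 'a training \<Rightarrow> nat \<Rightarrow> nat \<Rightarrow> real \<Rightarrow>
    ('w \<Rightarrow> nat \<Rightarrow> 'a \<times> real) \<Rightarrow> ('w \<Rightarrow> nat \<Rightarrow> 'a \<times> real) \<Rightarrow> 'w set" where
  "dkw_event M PX K \<alpha> f n m \<delta> Dtr Dcal =
    {\<omega> \<in> space M.
      (SUP t. \<bar>empirical_cdf m (Dcal \<omega>) (fitted_score \<alpha> f n (Dtr \<omega>)) t
               - score_cdf PX K (fitted_score \<alpha> f n (Dtr \<omega>)) t\<bar>) \<le> dkw_radius m \<delta>}"

end

(* Thresholding: inflating the oracle interval [q1, q2] by t changes its average coverage by at least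
   2 mu_low |t|, while sorting and the Lipschitz bound put the score CDF within 2 mu_up eps of that
   average. On the DKW event this forces |Q| <= (2 mu_up eps + eta + s) / (2 mu_low), and the Lipschitz
   bound turns the endpoint errors and Q into a pointwise coverage error, to which Minkowski applies.

   Probability: the sharp (Massart) constant in the DKW inequality is needed. An empirical CDF lies
   below the true one by more than e only if, for some k, at most k points fall in a set of mass
   k/m + e. Decompose by the first such k and compare with the sampling in which every point is
   discarded independently with a suitable probability 1 - r: at each first crossing the likelihood
   ratio is at least exp (2 m e^2), and the crossing events are disjoint. *)
theory Submission
  imports Defs
begin

text \<open>The radius \<eta> = sqrt (ln (4/\<delta>) / (2 m)) fixes the budget: the two training
  events take \<delta>/4 each, which leaves \<delta>/2 = 2 exp (-2 m \<eta>^2) for the two-sided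
  deviation. A larger prefactor or a smaller exponent would not fit. In the comparison with thinned
  sampling, one \<open>r\<close> has to serve all crossing levels at once. A tilt chosen separately
  for each level would put the crossing events under different measures, and their probabilities
  would no longer add up to at most 1. That a single \<open>r\<close> reaches the exponent
  everywhere is a question of calculus, settled in \<open>dkw_exponent\<close>. Continuity of the
  score CDF, a consequence of the upper mass bound, provides thresholds with mass exactly k/m + e.
  The two smallness conditions have separate jobs: the first controls how far the oracle interval is
  shrunk, including that it does not collapse; the second keeps its inflation in the range where the
  lower mass bound is available.\<close>

section \<open>The Dvoretzky--Kiefer--Wolfowitz--Massart inequality\<close>

lemma pinsker_binary:
  fixes t e :: real
  assumes "0 \<le> e" "e < t" "t < 1"
  shows "2 * e\<^sup>2 \<le> (t - e) * ln ((t - e) / t) + (1 - t + e) * ln ((1 - t + e) / (1 - t))"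
proof -
  define \<phi> where "\<phi> x = (t - x) * (ln (t - x) - ln t) + (1 - t + x) * (ln (1 - t + x) - ln (1 - t)) - 2 * x\<^sup>2" for x
  define \<phi>' where "\<phi>' x = (ln (1 - t + x) - ln (1 - t)) - (ln (t - x) - ln t) - 4 * x" for x
  define \<phi>'' where "\<phi>'' x = 1 / (1 - t + x) + 1 / (t - x) - 4" for x
  have d1: "(\<phi> has_real_derivative \<phi>' x) (at x)" if "x \<in> {0..e}" for x
    unfolding \<phi>_def \<phi>'_def using that assms
    by (auto intro!: derivative_eq_intros)
  have d2: "(\<phi>' has_real_derivative \<phi>'' x) (at x)" if "x \<in> {0..e}" for x
    unfolding \<phi>''_def \<phi>'_def using that assms
    by (auto intro!: derivative_eq_intros simp: divide_inverse)
  have d3: "0 \<le> \<phi>'' x" if "x \<in> {0..e}" for x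
  proof -
    define a where "a = t - x"
    have a: "0 < a" "a < 1" using that assms by (auto simp: a_def)
    have "\<phi>'' x = 1 / (1 - a) + 1 / a - 4" by (simp add: \<phi>''_def a_def)
    moreover have "1 / (1 - a) + 1 / a - 4 = (1 - 2 * a)\<^sup>2 / (a * (1 - a))"
      using a by (simp add: field_simps power2_eq_square)
    ultimately show ?thesis using a by simp
  qed
  \<comment> \<open>Both \<open>\<phi> 0\<close> and \<open>\<phi>' 0\<close> vanish, so convexity
    alone puts \<open>\<phi> e\<close> above the zero tangent. The constant 2 is half of 4, the
    minimum of 1/a + 1/(1 - a).\<close>
  have "\<phi>' 0 * (e - 0) \<le> \<phi> e - \<phi> 0"
    by (rule f''_imp_f'[of "{0..e}" \<phi> \<phi>' \<phi>'']) (use d1 d2 d3 assms in auto)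
  then show ?thesis using assms by (simp add: \<phi>_def \<phi>'_def ln_div)
qed

text \<open>The right side is 2 artanh x, whose derivative 2 / (1 - x^2) is at least 2. It is
  applied to 2e in \<open>kl_critical_point\<close> and to e^2 in
  \<open>dkw_exponent\<close>.\<close>

lemma two_mult_le_ln_quotient:
  fixes x :: real
  assumes "0 \<le> x" "x < 1"
  shows "2 * x \<le> ln ((1 + x) / (1 - x))"
proof -
  have "(\<lambda>x. ln (1 + x) - ln (1 - x) - 2 * x) 0 \<le> (\<lambda>x. ln (1 + x) - ln (1 - x) - 2 * x) x"
  proof (rule DERIV_nonneg_imp_nondecreasing[OF assms(1)])
    fix y :: real assume y: "0 \<le> y" "y \<le> x"
    have "0 < 1 - y" using y assms by simp
    have "0 \<le> 1 / (1 + y) + 1 / (1 - y) - 2"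
    proof -
      have "1 - y * y = (1 + y) * (1 - y)" by (simp add: algebra_simps)
      then have "1 - y * y \<noteq> 0" using y \<open>0 < 1 - y\<close> by simp
      have "1 / (1 + y) + 1 / (1 - y) - 2 = 2 * y\<^sup>2 / ((1 + y) * (1 - y))"
        using y \<open>0 < 1 - y\<close> \<open>1 - y * y \<noteq> 0\<close> by (simp add: divide_simps power2_eq_square) (simp add: algebra_simps)
      then show ?thesis using y \<open>0 < 1 - y\<close> by simp
    qed
    moreover have "((\<lambda>x. ln (1 + x) - ln (1 - x) - 2 * x) has_real_derivative (1 / (1 + y) + 1 / (1 - y) - 2)) (at y)"
      using y assms by (auto intro!: derivative_eq_intros)
    ultimately show "\<exists>z. ((\<lambda>x. ln (1 + x) - ln (1 - x) - 2 * x) has_real_derivative z) (at y) \<and> 0 \<le> z"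
      by blast
  qed
  then show ?thesis using assms by (simp add: ln_div)
qed

text \<open>With kl the binary relative entropy, the equation says that the derivative of kl (s - e,
  s) in s vanishes. Both bounds on the root are used in \<open>dkw_exponent\<close>:
  \<open>1/2 \<le> s\<close> for convexity at \<open>s\<close>, and
  \<open>s \<le> (1 + e) / 2\<close> for the estimate at the endpoint \<open>t = e\<close>.\<close>

lemma kl_critical_point:
  fixes e :: real
  assumes "0 < e" "e < 1"
  obtains s where "1/2 \<le> s" "e < s" "s \<le> (1 + e) / 2"
    "ln ((s - e) * (1 - s) / (s * (1 - s + e))) + e / (s * (1 - s)) = 0"
proof -
  define a where "a = max (1/2) e"
  \<comment> \<open>\<open>g\<close> has the sign of the derivative but no logarithm, hence it is
    continuous also at s = e, the left end of the bracket when e \<ge> 1/2.\<close>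
  define g where "g s = (s - e) * (1 - s) * exp (e / (s * (1 - s))) - s * (1 - s + e)" for s
  have a: "a \<le> (1 + e) / 2" "1/2 \<le> a" "e \<le> a" using assms by (auto simp: a_def)
  have g_pos_iff: "0 \<le> g s \<longleftrightarrow> 0 \<le> ln ((s - e) * (1 - s) / (s * (1 - s + e))) + e / (s * (1 - s))"
      and g_zero_iff: "g s = 0 \<longleftrightarrow> ln ((s - e) * (1 - s) / (s * (1 - s + e))) + e / (s * (1 - s)) = 0"
    if "e < s" "s < 1" for s
  proof -
    have pos: "0 < (s - e) * (1 - s)" "0 < s * (1 - s + e)" using that assms by auto
    define L where "L = ln ((s - e) * (1 - s) / (s * (1 - s + e))) + e / (s * (1 - s))"
    have "exp L = (s - e) * (1 - s) * exp (e / (s * (1 - s))) / (s * (1 - s + e))"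
      unfolding L_def using pos by (subst exp_add) simp
    then have "exp L * (s * (1 - s + e)) = (s - e) * (1 - s) * exp (e / (s * (1 - s)))"
      by (rule iffD1[OF nonzero_eq_divide_eq, rotated]) (use pos(2) in linarith)
    then have eq: "g s = s * (1 - s + e) * (exp L - 1)"
      unfolding g_def by (simp only: right_diff_distrib mult_1_right) (simp only: mult.commute)
    show "0 \<le> g s \<longleftrightarrow> 0 \<le> ln ((s - e) * (1 - s) / (s * (1 - s + e))) + e / (s * (1 - s))"
      unfolding eq L_def [symmetric] using pos(2) by (subst zero_le_mult_iff) auto
    show "g s = 0 \<longleftrightarrow> ln ((s - e) * (1 - s) / (s * (1 - s + e))) + e / (s * (1 - s)) = 0"
      unfolding eq L_def [symmetric] using pos(2) by auto
  qed
  have "g a \<le> 0"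
  proof (cases "e < 1/2")
    case False
    then have "a = e" by (simp add: a_def)
    then show ?thesis using assms by (simp add: g_def)
  next
    case True
    then have "a = 1/2" by (simp add: a_def)
    have "2 * (2 * e) \<le> ln ((1 + 2 * e) / (1 - 2 * e))"
      using True assms by (intro two_mult_le_ln_quotient) auto
    then have "exp (4 * e) \<le> (1 + 2 * e) / (1 - 2 * e)"
      using True assms by (subst (asm) ln_ge_iff) auto
    then have "(1 - 2 * e) * exp (4 * e) \<le> 1 + 2 * e"
      using True by (simp add: field_simps)
    moreover have "g (1/2) = ((1 - 2 * e) * exp (4 * e) - (1 + 2 * e)) / 4"
      by (simp add: g_def field_simps)
    ultimately show ?thesis unfolding \<open>a = 1/2\<close> by simp
  qed
  moreover have "0 \<le> g ((1 + e) / 2)"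
  proof (subst g_pos_iff)
    have e: "e < (1 + e) / 2" "(1 + e) / 2 < 1" using assms by auto
    show "e < (1 + e) / 2" "(1 + e) / 2 < 1" using e by auto
    have halves: "(1 + e) / 2 - e = (1 - e) / 2" "1 - (1 + e) / 2 = (1 - e) / 2" "(1 - e) / 2 + e = (1 + e) / 2"
      by (simp_all add: field_simps)
    have "ln (((1 + e) / 2 - e) * (1 - (1 + e) / 2) / ((1 + e) / 2 * (1 - (1 + e) / 2 + e)))
        = ln (((1 - e) / (1 + e))\<^sup>2)"
      unfolding halves by (simp add: power2_eq_square)
    also have "\<dots> = 2 * ln ((1 - e) / (1 + e))"
      using assms by (simp add: ln_realpow)
    finally have 1: "ln (((1 + e) / 2 - e) * (1 - (1 + e) / 2) / ((1 + e) / 2 * (1 - (1 + e) / 2 + e)))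
       = 2 * ln (1 - e) - 2 * ln (1 + e)" using assms by (simp add: ln_div)
    have 2: "e / ((1 + e) / 2 * (1 - (1 + e) / 2)) = 4 * e / (1 - e\<^sup>2)"
      using assms mult_strict_mono[of e 1 e 1] by (simp add: divide_simps power2_eq_square) (simp add: algebra_simps)
    \<comment> \<open>The derivative at s = (1 + e) / 2, as a function of e. It vanishes at 0 and is
      itself nondecreasing.\<close>
    define h :: "real \<Rightarrow> real" where "h = (\<lambda>x. 2 * ln (1 - x) - 2 * ln (1 + x) + 4 * x / (1 - x\<^sup>2))"
    have "h 0 \<le> h e"
    proof (rule DERIV_nonneg_imp_nondecreasing[of 0 e h])
      fix y assume y: "0 \<le> y" "y \<le> e"
      then have y1: "0 < 1 - y" "0 < 1 + y" using assms by auto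
      then have "0 < (1 - y) * (1 + y)" by simp
      then have y2: "0 < 1 - y\<^sup>2" by (simp add: algebra_simps power2_eq_square)
      let ?d = "- (2 / (1 - y)) - 2 / (1 + y) + (4 * (1 - y\<^sup>2) + 8 * y\<^sup>2) / (1 - y\<^sup>2)\<^sup>2"
      have "(h has_real_derivative ?d) (at y)"
        unfolding h_def using y1 y2 by (auto intro!: derivative_eq_intros simp: power2_eq_square)
      moreover have "?d = 8 * y\<^sup>2 / (1 - y\<^sup>2)\<^sup>2"
      proof -
        have quot: "4 / x = 4 * x / x\<^sup>2" if "x \<noteq> 0" for x :: real
          using that by (simp add: power2_eq_square)
        have "2 / (1 - y) + 2 / (1 + y) = 4 / (1 - y\<^sup>2)"
          using y1 y2 by (simp add: divide_simps power2_eq_square) (simp add: algebra_simps)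
        also have "\<dots> = 4 * (1 - y\<^sup>2) / (1 - y\<^sup>2)\<^sup>2" using y2 by (intro quot) simp
        finally show ?thesis unfolding add_divide_distrib by linarith
      qed
      ultimately show "\<exists>z. (h has_real_derivative z) (at y) \<and> 0 \<le> z"
        by (intro exI[of _ ?d] conjI) auto
    qed (use assms in auto)
    then show "0 \<le> ln (((1 + e) / 2 - e) * (1 - (1 + e) / 2) / ((1 + e) / 2 * (1 - (1 + e) / 2 + e))) +
         e / ((1 + e) / 2 * (1 - (1 + e) / 2))"
      unfolding 1 2 by (simp add: h_def)
  qed
  moreover have "continuous_on {a..(1 + e) / 2} g"
    unfolding g_def using a assms by (intro continuous_intros) auto
  ultimately obtain s where s: "a \<le> s" "s \<le> (1 + e) / 2" "g s = 0"
    using IVT'[of g a 0 "(1 + e) / 2"] a by blast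
  have "s \<noteq> e" using s assms by (auto simp: g_def)
  then have "e < s" "s < 1" using s a assms by auto
  then show thesis using that[of s] s a g_zero_iff by auto
qed

text \<open>The right-hand side below is \<open>1 / m\<close> times the log-likelihood ratio, at a crossing of the line
  \<open>t - e\<close> at time \<open>t\<close>, of the uniform law thinned with probability \<open>r\<close>. Taking \<open>r = (s - e) / s\<close> with \<open>s\<close>
  critical for \<open>t \<mapsto> kl (t - e, t)\<close> makes \<open>s\<close> a critical point of this expression, where Pinsker's
  inequality applies; to the left of the convex region it is concave, so the endpoint \<open>t = e\<close> suffices.\<close>

lemma dkw_exponent:
  fixes e :: real
  assumes e: "0 < e" "e < 1"
  obtains r where "0 < r" "r < 1"
    "\<And>t. e \<le> t \<Longrightarrow> t < 1 \<Longrightarrow> 2 * e\<^sup>2 \<le> (t - e) * ln r + (1 - t + e) * ln ((1 - r * t) / (1 - t))"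
proof -
  obtain s where s: "1/2 \<le> s" "e < s" "s \<le> (1 + e) / 2"
    and crit: "ln ((s - e) * (1 - s) / (s * (1 - s + e))) + e / (s * (1 - s)) = 0"
    using kl_critical_point[OF e] by blast
  define r where "r = (s - e) / s"
  define c where "c = e / s"
  have s1: "s < 1" "0 < s" using s e by auto
  have r: "0 < r" "r < 1" and c: "0 < c" and c_eq: "c = 1 - r" "c * s = e" "r * s = s - e"
    using s e s1 by (auto simp: r_def c_def field_simps)
  define V where "V t = (t - e) * ln r + (1 - t + e) * (ln (1 - r * t) - ln (1 - t))" for t
  define V' where "V' t = ln r - (ln (1 - r * t) - ln (1 - t)) + (1 - t + e) * (1 / (1 - t) - r / (1 - r * t))" for t
  \<comment> \<open>Up to a positive factor \<open>l\<close> is the second derivative of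
    \<open>V\<close>. Being affine, it changes sign at most once.\<close>
  define l where "l t = e * c + (1 - t) * (2 * r * e - c)" for t
  define V'' where "V'' t = c * l t / ((1 - r * t)\<^sup>2 * (1 - t)\<^sup>2)" for t
  have rt: "0 < 1 - r * t" if "0 \<le> t" "t < 1" for t
    using mult_strict_mono'[of r 1 t 1] that r by simp
  have d1: "(V has_real_derivative V' t) (at t)" if "0 \<le> t" "t < 1" for t
    unfolding V_def V'_def using rt[OF that] that r
    by (auto intro!: derivative_eq_intros simp: algebra_simps divide_inverse)
  have d2: "(V' has_real_derivative V'' t) (at t)" if t: "0 \<le> t" "t < 1" for t
  proof -
    define u where "u = 1 - t"
    define v where "v = 1 - r * t"
    have uv: "0 < u" "0 < v" using rt[OF t] t by (auto simp: u_def v_def)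
    have "((\<lambda>t. 1 / (1 - t)) has_real_derivative 1 / u\<^sup>2) (at t)"
        "((\<lambda>t. r / (1 - r * t)) has_real_derivative r\<^sup>2 / v\<^sup>2) (at t)"
      using uv by (auto intro!: derivative_eq_intros simp: u_def v_def power2_eq_square)
    moreover have "((\<lambda>t. ln (1 - r * t)) has_real_derivative - (r / v)) (at t)"
        "((\<lambda>t. ln (1 - t)) has_real_derivative - (1 / u)) (at t)"
        "((\<lambda>t. 1 - t + e) has_real_derivative - 1) (at t)"
      using uv by (auto intro!: derivative_eq_intros simp: u_def v_def)
    ultimately have "(V' has_real_derivative (0 - (- (r / v) - - (1 / u)) +
        (- 1 * (1 / (1 - t) - r / (1 - r * t)) + (1 / u\<^sup>2 - r\<^sup>2 / v\<^sup>2) * (1 - t + e)))) (at t)"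
      unfolding V'_def by (intro DERIV_add DERIV_diff DERIV_const DERIV_mult)
    then have "(V' has_real_derivative (r / v - 1 / u) - (1 / u - r / v) + (u + e) * (1 / u\<^sup>2 - r\<^sup>2 / v\<^sup>2)) (at t)"
      by (simp add: u_def v_def algebra_simps)
    moreover have "(r / v - 1 / u) - (1 / u - r / v) + (u + e) * (1 / u\<^sup>2 - r\<^sup>2 / v\<^sup>2) = V'' t"
    proof -
      have vu: "v = c + r * u" by (simp add: v_def u_def c_eq algebra_simps)
      have "(r / v - 1 / u) - (1 / u - r / v) + (u + e) * (1 / u\<^sup>2 - r\<^sup>2 / v\<^sup>2)
        = (2 * (r * u - v) * (u * v) + (u + e) * (v\<^sup>2 - r\<^sup>2 * u\<^sup>2)) / (v\<^sup>2 * u\<^sup>2)"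
        using uv by (simp add: divide_simps power2_eq_square)
      also have "2 * (r * u - v) * (u * v) + (u + e) * (v\<^sup>2 - r\<^sup>2 * u\<^sup>2) = c * (e * c + u * (2 * r * e - c))"
        unfolding vu by (simp add: algebra_simps power2_eq_square)
      finally show ?thesis by (simp add: V''_def l_def u_def v_def)
    qed
    ultimately show ?thesis by simp
  qed
  have V's: "V' s = 0"
  proof -
    have eq: "1 - r * s = 1 - s + e" using c_eq by simp
    have "V' s = ln r - (ln (1 - s + e) - ln (1 - s)) + (1 - s + e) * (1 / (1 - s) - r / (1 - s + e))"
      unfolding V'_def eq ..
    also have "(1 - s + e) * (1 / (1 - s) - r / (1 - s + e)) = e / (s * (1 - s))"
      using s s1 e by (simp add: r_def divide_simps) (simp add: algebra_simps)
    also have "ln r - (ln (1 - s + e) - ln (1 - s)) = ln ((s - e) * (1 - s) / (s * (1 - s + e)))"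
      using s s1 e by (simp add: r_def ln_div ln_mult)
    finally show ?thesis using crit by simp
  qed
  \<comment> \<open>This is where \<open>1/2 \<le> s\<close> enters: l s * s = e (2 s - 1) (1 - s +
    e).\<close>
  have ls: "0 \<le> l s"
  proof -
    have "l s * s = e * (c * s) + (1 - s) * (2 * (r * s) * e - c * s)"
      by (simp add: l_def algebra_simps)
    also have "\<dots> = e * (e + (1 - s) * (2 * (s - e) - 1))"
      unfolding c_eq(2,3) by (simp add: algebra_simps)
    also have "e + (1 - s) * (2 * (s - e) - 1) = (2 * s - 1) * (1 - s + e)"
      by (simp add: algebra_simps)
    finally have "0 \<le> l s * s" using s s1 e by simp
    then show ?thesis using s1 by (simp add: zero_le_mult_iff)
  qed
  have l_affine: "l ((1 - a) * x + a * y) = (1 - a) * l x + a * l y" for a x y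
    by (simp add: l_def algebra_simps)
  \<comment> \<open>Since r s = s - e, both logarithms at \<open>t = s\<close> become those of kl (s
    - e, s).\<close>
  have Vs: "2 * e\<^sup>2 \<le> V s"
    using pinsker_binary[of e s] s s1 e
    unfolding V_def c_eq(3) diff_diff_eq2 by (simp add: r_def ln_div diff_add_eq)
  have above: "V s \<le> V t" if t: "0 \<le> t" "t < 1" "0 \<le> l t" for t
  proof -
    have "0 \<le> V'' x \<and> 0 \<le> x \<and> x < 1" if x: "x \<in> closed_segment s t" for x
    proof -
      obtain a where a: "0 \<le> a" "a \<le> 1" "x = (1 - a) * s + a * t"
        using x by (auto simp: closed_segment_def)
      then have "0 \<le> l x" using l_affine ls t by simp
      moreover have "0 \<le> x" "x < 1"
        using x s1 t by (auto simp: closed_segment_eq_real_ivl split: if_splits)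
      ultimately show ?thesis using c by (auto simp: V''_def)
    qed
    then have "V' s * (t - s) \<le> V t - V s"
      by (intro f''_imp_f'[of "closed_segment s t" V V' V'']) (auto intro: d1 d2)
    then show ?thesis using V's by simp
  qed
  \<comment> \<open>At \<open>t = e\<close> the first term of \<open>V\<close> has the factor 0.
    What is left decreases in \<open>s\<close>, and at s = (1 + e) / 2 it equals ln ((1 + e^2) / (1
    - e^2)).\<close>
  have Ve: "2 * e\<^sup>2 \<le> V e"
  proof -
    have e2: "0 < 1 - e\<^sup>2" using e by (simp add: power_less_one_iff abs_square_less_1)
    have "2 * e\<^sup>2 \<le> ln ((1 + e\<^sup>2) / (1 - e\<^sup>2))"
      using e2 by (intro two_mult_le_ln_quotient) auto
    also have "\<dots> \<le> ln ((1 - r * e) / (1 - e))"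
    proof (rule ln_mono)
      have "(1 + e\<^sup>2) / (1 - e\<^sup>2) = 1 + e / ((1 + e) / 2) * (e / (1 - e))"
        using e e2 by (simp add: divide_simps power2_eq_square) (simp add: algebra_simps)
      also have "\<dots> \<le> 1 + e / s * (e / (1 - e))"
        using e s s1 by (intro add_left_mono mult_right_mono divide_left_mono) auto
      also have "\<dots> = (1 - r * e) / (1 - e)"
        unfolding c_def [symmetric] c_eq(1) using e by (simp add: divide_simps) (simp add: algebra_simps)
      finally show "(1 + e\<^sup>2) / (1 - e\<^sup>2) \<le> (1 - r * e) / (1 - e)" .
    qed (use e2 in \<open>auto intro!: divide_pos_pos add_pos_nonneg\<close>)
    also have "\<dots> = V e" using rt[of e] e by (simp add: V_def ln_div)
    finally show ?thesis .
  qed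
  have main: "2 * e\<^sup>2 \<le> V t" if t: "e \<le> t" "t < 1" for t
  proof (cases "0 \<le> l t")
    case True
    then show ?thesis using above[of t] t e Vs by auto
  next
    case False
    \<comment> \<open>\<open>t0\<close> is the zero of \<open>l\<close> between \<open>t\<close> and
      \<open>s\<close>. As \<open>l t < 0 < l 1\<close>, the function \<open>l\<close> increases and
      \<open>V\<close> is concave on the left of \<open>t0\<close>; there it lies above its chord
      from \<open>e\<close> to \<open>t0\<close>, and both ends are already bounded.\<close>
    define a where "a = l s / (l s - l t)"
    define t0 where "t0 = (1 - a) * s + a * t"
    have a: "0 \<le> a" "a \<le> 1" using False ls by (auto simp: a_def field_simps)
    have lt0: "l t0 = 0"
      unfolding t0_def l_affine a_def using False ls by (simp add: field_simps)
    have l1: "0 < l 1" using e c by (simp add: l_def)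
    have lin: "l x = l 1 + (1 - x) * (2 * r * e - c)" for x by (simp add: l_def)
    define k where "k = 2 * r * e - c"
    have k: "k < 0"
    proof (rule ccontr)
      assume "\<not> k < 0"
      then have "0 \<le> (1 - t) * k" using t by simp
      then show False using lin[of t] l1 False by (simp add: k_def)
    qed
    have mono: "l x \<le> l y \<longleftrightarrow> x \<le> y" for x y
      unfolding lin[of x] lin[of y] k_def[symmetric] using k by simp
    have "t \<le> t0" "t0 \<le> s" using mono[of t t0] mono[of t0 s] lt0 ls False by auto
    then have t0: "t \<le> t0" "t0 < 1" using s1 by auto
    have neg: "V'' x \<le> 0" if "x \<in> {e..t0}" for x
    proof -
      have "l x \<le> 0" using mono[of x t0] lt0 that by simp
      then show ?thesis using c by (simp add: V''_def divide_nonpos_nonneg mult_nonneg_nonpos)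
    qed
    have conc: "concave_on {e..t0} V"
      by (rule f''_le0_imp_concave[of _ V V' V'']) (use e t0 neg in \<open>auto intro!: d1 d2\<close>)
    have "t \<in> closed_segment e t0" using t t0 by (auto simp: closed_segment_eq_real_ivl)
    then obtain b where b: "0 \<le> b" "b \<le> 1" "t = (1 - b) * e + b * t0"
      by (auto simp: closed_segment_def)
    have "2 * e\<^sup>2 = (1 - b) * (2 * e\<^sup>2) + b * (2 * e\<^sup>2)" by (simp add: algebra_simps)
    also have "\<dots> \<le> (1 - b) * V e + b * V t0"
      using b Ve Vs above[of t0] lt0 t0 t e by (intro add_mono mult_left_mono) auto
    also have "\<dots> \<le> V ((1 - b) * e + b * t0)"
      using concave_onD[OF conc, of b e t0] b t t0 by auto
    finally show ?thesis unfolding b(3) [symmetric] .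
  qed
  show thesis
  proof (rule that[OF r])
    fix t assume t: "e \<le> t" "t < 1"
    show "2 * e\<^sup>2 \<le> (t - e) * ln r + (1 - t + e) * ln ((1 - r * t) / (1 - t))"
      using main[OF t] rt[of t] t e by (simp add: V_def ln_div)
  qed
qed

section \<open>Crossing events under a change of measure\<close>

lemma measure_PiM_cells:
  fixes N :: "'z measure" and c :: "'z \<Rightarrow> 'c"
  assumes "prob_space N" "finite I" and c[measurable]: "c \<in> N \<rightarrow>\<^sub>M count_space UNIV"
    and R: "finite R" "R \<subseteq> extensional I"
  shows "measure (PiM I (\<lambda>_. N)) {D \<in> space (PiM I (\<lambda>_. N)). restrict (\<lambda>i. c (D i)) I \<in> R}
    = (\<Sum>s\<in>R. \<Prod>i\<in>I. measure N {z \<in> space N. c z = s i})"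
proof -
  interpret N: prob_space N by fact
  interpret P: finite_product_prob_space "\<lambda>_. N" I
    by standard (fact \<open>finite I\<close>)
  let ?B = "\<lambda>s. PiE I (\<lambda>i. {z \<in> space N. c z = s i})"
  have [measurable]: "{z \<in> space N. c z = a} \<in> sets N" for a by measurable
  have B: "?B s \<in> sets (PiM I (\<lambda>_. N))" for s
    using \<open>finite I\<close> by (intro sets_PiM_I_finite) auto
  have "{D \<in> space (PiM I (\<lambda>_. N)). restrict (\<lambda>i. c (D i)) I \<in> R} = (\<Union>s\<in>R. ?B s)"
  proof (intro set_eqI iffI)
    fix D assume D: "D \<in> {D \<in> space (PiM I (\<lambda>_. N)). restrict (\<lambda>i. c (D i)) I \<in> R}"
    then have "D \<in> ?B (restrict (\<lambda>i. c (D i)) I)" by (auto simp: space_PiM)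
    then show "D \<in> (\<Union>s\<in>R. ?B s)" using D by blast
  next
    fix D assume "D \<in> (\<Union>s\<in>R. ?B s)"
    then obtain s where s: "s \<in> R" "D \<in> ?B s" by blast
    then have "restrict (\<lambda>i. c (D i)) I = s" using R(2) by (fastforce simp: extensional_def restrict_def)
    then show "D \<in> {D \<in> space (PiM I (\<lambda>_. N)). restrict (\<lambda>i. c (D i)) I \<in> R}"
      using s by (auto simp: space_PiM)
  qed
  \<comment> \<open>The patterns in \<open>R\<close> are extensional, so distinct ones differ at an
    index in \<open>I\<close> and their boxes are disjoint.\<close>
  moreover have "disjoint_family_on ?B R"
    unfolding disjoint_family_on_def
  proof (intro ballI impI)
    fix s s' assume ss: "s \<in> R" "s' \<in> R" "s \<noteq> s'"
    then have "s \<in> extensional I" "s' \<in> extensional I" using R by auto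
    then obtain i where "i \<in> I" "s i \<noteq> s' i" using ss(3) by (meson extensionalityI)
    then show "?B s \<inter> ?B s' = {}" by (fastforce simp: PiE_iff)
  qed
  ultimately have "measure (PiM I (\<lambda>_. N)) {D \<in> space (PiM I (\<lambda>_. N)). restrict (\<lambda>i. c (D i)) I \<in> R}
      = (\<Sum>s\<in>R. measure (PiM I (\<lambda>_. N)) (?B s))"
    using B R(1) by (simp add: P.finite_measure_finite_Union image_subset_iff)
  also have "\<dots> = (\<Sum>s\<in>R. \<Prod>i\<in>I. measure N {z \<in> space N. c z = s i})"
    by (intro sum.cong refl P.finite_measure_PiM_emb) auto
  finally show ?thesis .
qed

text \<open>The label \<open>s i\<close> is the first level that contains point \<open>i\<close>;
  \<open>k\<close> is the first time the count of labels comes down to the diagonal. Equality can be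
  demanded because the count is nondecreasing and integer valued: more than \<open>k - 1\<close> at
  \<open>k - 1\<close> means at least \<open>k\<close> at \<open>k\<close>. The exact count is the
  exponent of \<open>r\<close> in the likelihood ratio.\<close>

definition first_passage :: "'i set \<Rightarrow> nat \<Rightarrow> ('i \<Rightarrow> nat) \<Rightarrow> bool" where
  "first_passage I k s \<longleftrightarrow> card {i \<in> I. s i \<le> k} = k \<and> (\<forall>j<k. j < card {i \<in> I. s i \<le> j})"

lemma first_passage_unique:
  assumes "first_passage I k s" "first_passage I l s"
  shows "k = l"
  using assms unfolding first_passage_def by (metis less_irrefl linorder_neqE_nat)

lemma first_passage_exists:
  assumes "finite I" "card {i \<in> I. s i \<le> k} \<le> k"
  shows "\<exists>l\<le>k. first_passage I l s"
proof -
  define l where "l = (LEAST l. card {i \<in> I. s i \<le> l} \<le> l)"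
  have l: "card {i \<in> I. s i \<le> l} \<le> l" "l \<le> k"
    unfolding l_def using assms(2) by (auto intro: LeastI Least_le)
  have less: "j < card {i \<in> I. s i \<le> j}" if "j < l" for j
    using not_less_Least[OF that[unfolded l_def]] by simp
  have "l \<le> card {i \<in> I. s i \<le> l}"
  proof (cases l)
    case (Suc j)
    have "j < card {i \<in> I. s i \<le> j}" using less Suc by simp
    also have "\<dots> \<le> card {i \<in> I. s i \<le> l}" using Suc assms(1) by (intro card_mono) auto
    finally show ?thesis using Suc by simp
  qed simp
  then show ?thesis using l less unfolding first_passage_def by (intro exI[of _ l]) auto
qed

text \<open>A first passage at \<open>k\<close> depends only on the labels up to \<open>k\<close>,
  so all larger ones are merged into \<open>Suc k\<close>. This is what gives them the common ratio
  \<open>w\<close> in \<open>binomial_lower_crossing\<close>.\<close>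

lemma measure_first_passage:
  fixes N :: "'z measure" and c :: "'z \<Rightarrow> nat"
  assumes "prob_space N" "finite I" and c[measurable]: "c \<in> N \<rightarrow>\<^sub>M count_space UNIV"
  shows "measure (PiM I (\<lambda>_. N)) {D \<in> space (PiM I (\<lambda>_. N)). first_passage I k (\<lambda>i. c (D i))}
    = (\<Sum>s\<in>{s \<in> PiE I (\<lambda>_. {..Suc k}). first_passage I k s}.
        \<Prod>i\<in>I. measure N {z \<in> space N. min (c z) (Suc k) = s i})"
proof -
  let ?R = "{s \<in> PiE I (\<lambda>_. {..Suc k}). first_passage I k s}"
  have "first_passage I k (restrict (\<lambda>i. min (s i) (Suc k)) I) \<longleftrightarrow> first_passage I k s" for s
  proof -
    have "{i \<in> I. restrict (\<lambda>i. min (s i) (Suc k)) I i \<le> j} = {i \<in> I. s i \<le> j}" if "j \<le> k" for j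
      using that by auto
    then show ?thesis unfolding first_passage_def by auto
  qed
  then have "{D \<in> space (PiM I (\<lambda>_. N)). first_passage I k (\<lambda>i. c (D i))}
    = {D \<in> space (PiM I (\<lambda>_. N)). restrict (\<lambda>i. min (c (D i)) (Suc k)) I \<in> ?R}"
    by auto
  moreover have "finite ?R" using finite_PiE[OF assms(2), of "\<lambda>_. {..Suc k}"] by auto
  ultimately show ?thesis
    using measure_PiM_cells[OF assms(1,2), of "\<lambda>z. min (c z) (Suc k)" ?R] by (auto simp: PiE_def)
qed

lemma binomial_lower_crossing:
  fixes N :: "'z measure" and B :: "nat \<Rightarrow> 'z set" and m K :: nat and e :: real
  assumes "prob_space N" and m: "1 \<le> m" and e: "0 < e" and K: "K / m + e < 1"
    and B: "\<And>k. k \<le> K \<Longrightarrow> B k \<in> sets N"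
    and nested: "\<And>j k. j \<le> k \<Longrightarrow> k \<le> K \<Longrightarrow> B j \<subseteq> B k"
    and t: "\<And>k. k \<le> K \<Longrightarrow> measure N (B k) = k / m + e"
  shows "measure (PiM {1..m} (\<lambda>_. N))
      {D \<in> space (PiM {1..m} (\<lambda>_. N)). \<exists>k\<le>K. card {i \<in> {1..m}. D i \<in> B k} \<le> k} \<le> exp (- 2 * real m * e\<^sup>2)"
proof -
  interpret N: prob_space N by fact
  have m0: "0 < real m" using m by simp
  have "0 \<le> K / m" by simp
  then have "e < 1" using K by linarith
  then obtain r where r: "0 < r" "r < 1" and V: "\<And>t. e \<le> t \<Longrightarrow> t < 1 \<Longrightarrow>
      2 * e\<^sup>2 \<le> (t - e) * ln r + (1 - t + e) * ln ((1 - r * t) / (1 - t))"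
    using dkw_exponent[OF e] by blast
  \<comment> \<open>The first level containing \<open>z\<close>, with \<open>Suc K\<close> for
    points outside all levels; admitting \<open>Suc K\<close> makes the \<open>LEAST\<close> always
    attained.\<close>
  define c where "c z = (LEAST k. k = Suc K \<or> z \<in> B k)" for z
  have c_le_Suc: "c z \<le> Suc K" for z unfolding c_def by (rule Least_le) simp
  have c_le: "c z \<le> k \<longleftrightarrow> z \<in> B k" if "k \<le> K" for z k
  proof
    assume "z \<in> B k"
    then show "c z \<le> k" unfolding c_def by (intro Least_le) simp
  next
    assume "c z \<le> k"
    moreover have "c z = Suc K \<or> z \<in> B (c z)"
      unfolding c_def by (rule LeastI[of _ "Suc K"]) simp
    ultimately show "z \<in> B k" using nested[of "c z" k] that by auto
  qed
  have c_meas: "c \<in> N \<rightarrow>\<^sub>M count_space UNIV"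
  proof (rule measurable_count_space_eq2_countable[THEN iffD2], intro conjI ballI)
    fix k
    have le: "{z \<in> space N. c z \<le> j} \<in> sets N" for j
    proof (cases "j \<le> K")
      case True
      then have "{z \<in> space N. c z \<le> j} = B j" using sets.sets_into_space[OF B[OF True]] c_le by auto
      then show ?thesis using B[OF True] by simp
    next
      case False
      then have "{z \<in> space N. c z \<le> j} = space N" using c_le_Suc order_trans[OF c_le_Suc, of j] by auto
      then show ?thesis by simp
    qed
    have lt: "(if k = 0 then {} else {z \<in> space N. c z \<le> k - 1}) \<in> sets N" using le by simp
    have "c -` {k} \<inter> space N = {z \<in> space N. c z \<le> k} - (if k = 0 then {} else {z \<in> space N. c z \<le> k - 1})"
      by auto
    then show "c -` {k} \<inter> space N \<in> sets N" using sets.Diff[OF le lt] by (simp only:)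
  qed auto
  note [measurable] = c_meas
  \<comment> \<open>Tilted sampling: with probability \<open>1 - r\<close> a point is moved outside all \<open>B k\<close>. Stopped at the first
    crossing \<open>k\<close>, its likelihood ratio against \<open>N\<close> is \<open>r ^ k * w ^ (m - k) \<ge> exp (2 m e\<^sup>2)\<close>.\<close>
  define Q where "Q = N \<Otimes>\<^sub>M measure_pmf (bernoulli_pmf r)"
  define d where "d = (\<lambda>(z, b). if b then c z else Suc K)"
  interpret Q: pair_prob_space N "measure_pmf (bernoulli_pmf r)" ..
  have pmeas: "measure (N \<Otimes>\<^sub>M measure_pmf (bernoulli_pmf r)) (X \<times> {True}) = measure N X * r" if "X \<in> sets N" for X
    using that r by (simp add: measure_pmf.emeasure_pair_measure_Times measure_def enn2real_mult emeasure_pmf_single)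
  have Q: "prob_space Q" unfolding Q_def by unfold_locales
  have [measurable]: "d \<in> Q \<rightarrow>\<^sub>M count_space UNIV" unfolding d_def Q_def by measurable
  let ?I = "{1..m}"
  let ?E = "\<lambda>k. {D \<in> space (PiM ?I (\<lambda>_. N)). first_passage ?I k (\<lambda>i. c (D i))}"
  let ?F = "\<lambda>k. {D \<in> space (PiM ?I (\<lambda>_. Q)). first_passage ?I k (\<lambda>i. d (D i))}"
  interpret PN: finite_product_prob_space "\<lambda>_. N" ?I by standard simp
  interpret PQ: prob_space "PiM ?I (\<lambda>_. Q)" using Q by (intro prob_space_PiM)
  have EF [measurable]: "?E k \<in> sets (PiM ?I (\<lambda>_. N))" "?F k \<in> sets (PiM ?I (\<lambda>_. Q))" for k
    unfolding first_passage_def by measurable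
  have change: "measure (PiM ?I (\<lambda>_. N)) (?E k) \<le> exp (- 2 * real m * e\<^sup>2) * measure (PiM ?I (\<lambda>_. Q)) (?F k)"
    if k: "k \<le> K" for k
  proof -
    define T where "T = k / m + e"
    have kK: "k / m \<le> K / m" using k m0 by (simp add: divide_right_mono)
    have "0 \<le> k / m" by simp
    then have T: "e \<le> T" "T < 1" using K kK unfolding T_def by linarith+
    have "k / m < 1" using K kK e by linarith
    then have km: "k < m" using m0 by simp
    have rT: "0 < 1 - r * T" using mult_strict_mono'[of r 1 T 1] r T e by simp
    \<comment> \<open>\<open>w\<close> compares the masses outside \<open>B k\<close> under
      \<open>Q\<close> and \<open>N\<close>; it is finite because the assumption on \<open>K\<close>
      gives \<open>T < 1\<close>. Inside \<open>B k\<close> thinning multiplies every mass by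
      \<open>r\<close>.\<close>
    define w where "w = (1 - r * T) / (1 - T)"
    have w: "0 < w" using rT T by (simp add: w_def)
    define g where "g j = (if j \<le> k then r else w)" for j :: nat
    have cell: "measure Q {z \<in> space Q. min (d z) (Suc k) = j} = g j * measure N {z \<in> space N. min (c z) (Suc k) = j}"
      if j: "j \<le> Suc k" for j
    proof (cases "j \<le> k")
      case True
      have "{z \<in> space Q. min (d z) (Suc k) = j} = {z \<in> space N. min (c z) (Suc k) = j} \<times> {True}"
        using True k unfolding Q_def d_def by (auto simp: space_pair_measure min_def split: if_splits)
      then show ?thesis using r True unfolding Q_def
        by (simp add: pmeas measure_pmf_single g_def)
    next
      case False
      have "measure Q {z \<in> space Q. d z \<le> k} = measure Q (B k \<times> {True})"
        using k sets.sets_into_space[OF B[OF k]] unfolding Q_def d_def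
        by (intro arg_cong[of _ _ "measure _"]) (auto simp: space_pair_measure c_le split: if_splits)
      also have "\<dots> = r * T"
        using r B[OF k] t[OF k] unfolding Q_def by (simp add: pmeas measure_pmf_single T_def)
      finally have "measure Q {z \<in> space Q. \<not> d z \<le> k} = 1 - r * T"
        using prob_space.prob_neg[OF Q, of "\<lambda>z. d z \<le> k"] by simp
      moreover have "measure N {z \<in> space N. c z \<le> k} = T"
        using sets.sets_into_space[OF B[OF k]] t[OF k] c_le[OF k]
        by (simp add: T_def Int_absorb1 flip: Int_def)
      then have "measure N {z \<in> space N. \<not> c z \<le> k} = 1 - T"
        using N.prob_neg[of "\<lambda>z. c z \<le> k"] by simp
      moreover have "min x (Suc k) = j \<longleftrightarrow> \<not> x \<le> k" for x
        using False j by auto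
      ultimately show ?thesis using False T by (simp add: g_def w_def)
    qed
    have weight: "exp (2 * real m * e\<^sup>2) \<le> (\<Prod>i\<in>?I. g (s i))" if "first_passage ?I k s" for s
    proof -
      have ck: "card {i \<in> ?I. s i \<le> k} = k" using that by (simp add: first_passage_def)
      have "?I \<inter> {i. s i \<le> k} = {i \<in> ?I. s i \<le> k}" "?I \<inter> - {i. s i \<le> k} = ?I - {i \<in> ?I. s i \<le> k}"
        by auto
      moreover have "card (?I - {i \<in> ?I. s i \<le> k}) = m - k"
        using ck by (subst card_Diff_subset) auto
      ultimately have "(\<Prod>i\<in>?I. g (s i)) = r ^ k * w ^ (m - k)"
        unfolding g_def using ck by (subst prod.If_cases) auto
      also have "\<dots> = exp (k * ln r + (m - k) * ln w)"
        using r w by (simp add: exp_add exp_of_nat_mult)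
      \<comment> \<open>Here k = m (T - e) and m - k = m (1 - T + e), the two weights of
        \<open>dkw_exponent\<close>.\<close>
      also have "k * ln r + (m - k) * ln w = m * ((T - e) * ln r + (1 - T + e) * ln w)"
        using m0 km by (simp add: T_def algebra_simps)
      finally show ?thesis
        using mult_left_mono[OF V[OF T], of "real m"] by (simp add: w_def mult.assoc mult.left_commute)
    qed
    have "exp (2 * real m * e\<^sup>2) * measure (PiM ?I (\<lambda>_. N)) (?E k) \<le> measure (PiM ?I (\<lambda>_. Q)) (?F k)"
      unfolding measure_first_passage[OF \<open>prob_space N\<close> finite_atLeastAtMost c_meas]
        measure_first_passage[OF Q finite_atLeastAtMost \<open>d \<in> _\<close>] sum_distrib_left
    proof (rule sum_mono)
      fix s assume "s \<in> {s \<in> ?I \<rightarrow>\<^sub>E {..Suc k}. first_passage ?I k s}"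
      then have s: "\<And>i. i \<in> ?I \<Longrightarrow> s i \<le> Suc k" "first_passage ?I k s" by auto
      have "exp (2 * real m * e\<^sup>2) * (\<Prod>i\<in>?I. measure N {z \<in> space N. min (c z) (Suc k) = s i})
          \<le> (\<Prod>i\<in>?I. g (s i)) * (\<Prod>i\<in>?I. measure N {z \<in> space N. min (c z) (Suc k) = s i})"
        by (intro mult_right_mono weight s prod_nonneg) auto
      also have "\<dots> = (\<Prod>i\<in>?I. measure Q {z \<in> space Q. min (d z) (Suc k) = s i})"
        unfolding prod.distrib [symmetric] using s(1) by (intro prod.cong refl cell [symmetric]) auto
      finally show "exp (2 * real m * e\<^sup>2) * (\<Prod>i\<in>?I. measure N {z \<in> space N. min (c z) (Suc k) = s i})
          \<le> (\<Prod>i\<in>?I. measure Q {z \<in> space Q. min (d z) (Suc k) = s i})" .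
    qed
    then have "exp (- 2 * real m * e\<^sup>2) * (exp (2 * real m * e\<^sup>2) * measure (PiM ?I (\<lambda>_. N)) (?E k))
        \<le> exp (- 2 * real m * e\<^sup>2) * measure (PiM ?I (\<lambda>_. Q)) (?F k)"
      by (intro mult_left_mono) auto
    then show ?thesis by (simp add: mult.assoc [symmetric] exp_add [symmetric])
  qed
  have "measure (PiM ?I (\<lambda>_. N)) {D \<in> space (PiM ?I (\<lambda>_. N)). \<exists>k\<le>K. card {i \<in> ?I. D i \<in> B k} \<le> k}
      \<le> measure (PiM ?I (\<lambda>_. N)) (\<Union>k\<le>K. ?E k)"
  proof (rule PN.finite_measure_mono)
    show "{D \<in> space (PiM ?I (\<lambda>_. N)). \<exists>k\<le>K. card {i \<in> ?I. D i \<in> B k} \<le> k} \<subseteq> (\<Union>k\<le>K. ?E k)"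
    proof safe
      fix D k assume D: "D \<in> space (PiM ?I (\<lambda>_. N))" "k \<le> K" "card {i \<in> ?I. D i \<in> B k} \<le> k"
      then have "card {i \<in> ?I. c (D i) \<le> k} \<le> k" by (simp add: c_le)
      then obtain l where "l \<le> k" "first_passage ?I l (\<lambda>i. c (D i))"
        using first_passage_exists[of ?I "\<lambda>i. c (D i)" k] by auto
      then show "D \<in> (\<Union>k\<le>K. ?E k)" using D by auto
    qed
  qed measurable
  also have "\<dots> \<le> (\<Sum>k\<le>K. measure (PiM ?I (\<lambda>_. N)) (?E k))"
    by (rule PN.finite_measure_subadditive_finite) (use EF(1) in blast)+
  also have "\<dots> \<le> (\<Sum>k\<le>K. exp (- 2 * real m * e\<^sup>2) * measure (PiM ?I (\<lambda>_. Q)) (?F k))"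
    by (intro sum_mono change) auto
  also have "\<dots> = exp (- 2 * real m * e\<^sup>2) * (\<Sum>k\<le>K. measure (PiM ?I (\<lambda>_. Q)) (?F k))"
    by (simp add: sum_distrib_left)
  \<comment> \<open>No factor for the number of levels arises: first passages at different
    \<open>k\<close> exclude each other under one and the same measure.\<close>
  also have "(\<Sum>k\<le>K. measure (PiM ?I (\<lambda>_. Q)) (?F k)) = measure (PiM ?I (\<lambda>_. Q)) (\<Union>k\<le>K. ?F k)"
    by (rule PQ.finite_measure_finite_Union [symmetric])
       (use EF(2) in \<open>auto simp: disjoint_family_on_def simp del: One_nat_def dest: first_passage_unique\<close>)
  also have "\<dots> \<le> 1" by (rule PQ.prob_le_1)
  finally show ?thesis by simp
qed

text \<open>If \<open>C t\<close> holds exactly \<open>k\<close> points and the deviation exceeds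
  \<open>e\<close>, the threshold \<open>x k\<close> of mass k/m + e lies to the left of
  \<open>t\<close>, so its set holds at most \<open>k\<close> points. Thus finitely many crossings
  cover the deviations at all real \<open>t\<close>. The family \<open>C\<close> is abstract because
  both closed sublevel sets and open superlevel sets of a score are needed.\<close>

lemma dkw_one_sided:
  fixes N :: "'z measure" and C :: "real \<Rightarrow> 'z set" and m :: nat and e :: real
  assumes "prob_space N" and m: "1 \<le> m" and e: "0 < e"
    and C: "\<And>t. C t \<in> sets N" and mono: "\<And>s t. s \<le> t \<Longrightarrow> C s \<subseteq> C t"
    and cont: "continuous_on UNIV (\<lambda>t. measure N (C t))"
    and bot: "((\<lambda>t. measure N (C t)) \<longlongrightarrow> 0) at_bot" and top: "((\<lambda>t. measure N (C t)) \<longlongrightarrow> 1) at_top"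
  obtains E where "E \<in> sets (PiM {1..m} (\<lambda>_. N))" "measure (PiM {1..m} (\<lambda>_. N)) E \<le> exp (- 2 * real m * e\<^sup>2)"
    "\<And>D t. D \<in> space (PiM {1..m} (\<lambda>_. N)) \<Longrightarrow> e < measure N (C t) - card {i \<in> {1..m}. D i \<in> C t} / m \<Longrightarrow> D \<in> E"
proof (cases "e < 1")
  case False
  interpret prob_space N by fact
  have "\<not> e < measure N (C t) - card {i \<in> {1..m}. D i \<in> C t} / m" for t and D :: "nat \<Rightarrow> 'z"
  proof -
    have "0 \<le> card {i \<in> {1..m}. D i \<in> C t} / m" by simp
    then show ?thesis using prob_le_1[of "C t"] False by linarith
  qed
  then show thesis by (intro that[of "{}"]) auto
next
  case True
  interpret prob_space N by fact
  define G where "G t = measure N (C t)" for t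
  have m0: "0 < real m" using m by simp
  let ?S = "{k :: nat. k / m + e < 1}"
  have S_le: "?S \<subseteq> {..m}"
  proof safe
    fix k :: nat assume "k / m + e < 1"
    then have "k / m < 1" using e by linarith
    then show "k \<le> m" using m0 by simp
  qed
  then have fin: "finite ?S" by (rule finite_subset) simp
  have "0 \<in> ?S" using True by simp
  define K where "K = Max ?S"
  have K: "K / m + e < 1" using Max_in[OF fin] \<open>0 \<in> ?S\<close> unfolding K_def by blast
  have K_iff: "k \<le> K \<longleftrightarrow> k / m + e < 1" for k :: nat
  proof
    assume "k \<le> K"
    then have "k / m \<le> K / m" using m0 by (simp add: divide_right_mono)
    then show "k / m + e < 1" using K by linarith
  qed (use fin in \<open>auto simp: K_def\<close>)
  have "\<exists>x. G x = v" if "0 < v" "v < 1" for v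
  proof -
    have "eventually (\<lambda>t. G t < v) at_bot" "eventually (\<lambda>t. v < G t) at_top"
      using order_tendstoD(2)[OF bot] order_tendstoD(1)[OF top] that by (auto simp: G_def)
    then obtain a b where ab: "G a < v" "v < G b"
      by (auto simp: eventually_at_bot_linorder eventually_at_top_linorder)
    then have "a \<le> b" using finite_measure_mono[OF mono[of b a] C] by (force simp: G_def)
    moreover have "continuous_on {a..b} G" using cont unfolding G_def by (rule continuous_on_subset) simp
    ultimately show ?thesis using IVT'[of G a v b] ab by auto
  qed
  moreover have "0 < k / m + e" for k :: nat using e by (simp add: add_nonneg_pos)
  ultimately have "\<forall>k. \<exists>x. k \<le> K \<longrightarrow> G x = k / m + e" using K_iff by blast
  then obtain x where x: "\<And>k. k \<le> K \<Longrightarrow> G (x k) = k / m + e" by metis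
  have G_less: "s < t" if "G s < G t" for s t
    using that finite_measure_mono[OF mono[of t s] C] by (force simp: G_def)
  define E where "E = {D \<in> space (PiM {1..m} (\<lambda>_. N)). \<exists>k\<le>K. card {i \<in> {1..m}. D i \<in> C (x k)} \<le> k}"
  show thesis
  proof (rule that[of E])
    show "E \<in> sets (PiM {1..m} (\<lambda>_. N))"
      unfolding E_def using C by measurable
    show "measure (PiM {1..m} (\<lambda>_. N)) E \<le> exp (- 2 * real m * e\<^sup>2)"
      unfolding E_def
    proof (rule binomial_lower_crossing[OF \<open>prob_space N\<close> m e K])
      fix j k assume jk: "j \<le> k" "k \<le> K"
      show "C (x j) \<subseteq> C (x k)"
      proof (cases "j = k")
        case False
        then have "real j / m < k / m" using jk m0 by (simp add: divide_strict_right_mono)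
        then have "G (x j) < G (x k)" using jk x[of j] x[of k] by simp
        then show ?thesis by (rule mono[OF less_imp_le[OF G_less]])
      qed simp
    qed (use C x in \<open>auto simp: G_def\<close>)
    fix D t assume D: "D \<in> space (PiM {1..m} (\<lambda>_. N))" and "e < measure N (C t) - card {i \<in> {1..m}. D i \<in> C t} / m"
    then have *: "card {i \<in> {1..m}. D i \<in> C t} / m + e < G t" (is "real ?k / _ + _ < _") by (simp add: G_def)
    then have "?k \<le> K" using prob_le_1[of "C t"] unfolding K_iff G_def by linarith
    then have "G (x ?k) < G t" using * x by simp
    then have "x ?k \<le> t" by (rule less_imp_le[OF G_less])
    then have "card {i \<in> {1..m}. D i \<in> C (x ?k)} \<le> ?k" using mono by (intro card_mono) auto
    then show "D \<in> E" using D \<open>?k \<le> K\<close> unfolding E_def by blast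
  qed
qed

section \<open>The two-sided inequality for an atomless score\<close>

lemma empirical_cdf_eq: "empirical_cdf m D S t = card {i \<in> {1..m}. S (D i) \<le> t} / m"
  by (simp add: empirical_cdf_def Int_def)

text \<open>Atomlessness makes the CDF of \<open>S\<close> continuous. The deviations are only
  enclosed in a measurable \<open>E\<close>; that their union over \<open>t\<close> is measurable is
  obtained later through rational \<open>t\<close>.\<close>

lemma dkw_massart:
  fixes N :: "'z measure" and S :: "'z \<Rightarrow> real" and m :: nat and e :: real
  assumes "prob_space N" and m: "1 \<le> m" and e: "0 < e"
    and S [measurable]: "S \<in> borel_measurable N" and atomless: "\<And>t. measure N {z \<in> space N. S z = t} = 0"
  obtains E where "E \<in> sets (PiM {1..m} (\<lambda>_. N))" "measure (PiM {1..m} (\<lambda>_. N)) E \<le> 2 * exp (- 2 * real m * e\<^sup>2)"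
    "\<And>D t. D \<in> space (PiM {1..m} (\<lambda>_. N)) \<Longrightarrow>
      e < \<bar>empirical_cdf m D S t - measure N {z \<in> space N. S z \<le> t}\<bar> \<Longrightarrow> D \<in> E"
proof -
  interpret N: prob_space N by fact
  interpret L: real_distribution "distr N borel S" by (rule N.real_distribution_distr) simp
  have F: "measure N {z \<in> space N. S z \<le> t} = cdf (distr N borel S) t" for t
    by (simp add: cdf_def measure_distr vimage_def Int_def conj_commute)
  have F': "measure N {z \<in> space N. - t < S z} = 1 - cdf (distr N borel S) (- t)" for t
    unfolding F [symmetric] using N.prob_neg[of "\<lambda>z. S z \<le> - t"] by (simp add: not_le)
  have "measure (distr N borel S) {t} = 0" for t
    using atomless[of t] by (simp add: measure_distr vimage_def Int_def conj_commute)
  then have cont: "isCont (cdf (distr N borel S)) t" for t by (simp add: L.isCont_cdf)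
  obtain E1 where E1: "E1 \<in> sets (PiM {1..m} (\<lambda>_. N))" "measure (PiM {1..m} (\<lambda>_. N)) E1 \<le> exp (- 2 * real m * e\<^sup>2)"
    "\<And>D t. D \<in> space (PiM {1..m} (\<lambda>_. N)) \<Longrightarrow> e < measure N {z \<in> space N. S z \<le> t}
       - card {i \<in> {1..m}. D i \<in> {z \<in> space N. S z \<le> t}} / m \<Longrightarrow> D \<in> E1"
  proof (rule dkw_one_sided[of N m e "\<lambda>t. {z \<in> space N. S z \<le> t}"])
    show "continuous_on UNIV (\<lambda>t. measure N {z \<in> space N. S z \<le> t})"
      unfolding F using cont by (intro continuous_at_imp_continuous_on) auto
    show "((\<lambda>t. measure N {z \<in> space N. S z \<le> t}) \<longlongrightarrow> 0) at_bot"
      unfolding F by (rule L.cdf_lim_at_bot)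
    show "((\<lambda>t. measure N {z \<in> space N. S z \<le> t}) \<longlongrightarrow> 1) at_top"
      unfolding F by (rule L.cdf_lim_at_top_prob)
  qed (use assms in auto)
  \<comment> \<open>The upper deviations of \<open>S\<close> are the lower deviations of \<open>- S\<close>.\<close>
  obtain E2 where E2: "E2 \<in> sets (PiM {1..m} (\<lambda>_. N))" "measure (PiM {1..m} (\<lambda>_. N)) E2 \<le> exp (- 2 * real m * e\<^sup>2)"
    "\<And>D t. D \<in> space (PiM {1..m} (\<lambda>_. N)) \<Longrightarrow> e < measure N {z \<in> space N. - t < S z}
       - card {i \<in> {1..m}. D i \<in> {z \<in> space N. - t < S z}} / m \<Longrightarrow> D \<in> E2"
  proof (rule dkw_one_sided[of N m e "\<lambda>t. {z \<in> space N. - t < S z}"])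
    show "continuous_on UNIV (\<lambda>t. measure N {z \<in> space N. - t < S z})"
    proof (rule continuous_at_imp_continuous_on, intro ballI)
      fix t
      have "isCont (\<lambda>t. cdf (distr N borel S) (- t)) t"
        by (rule isCont_o2[OF _ cont]) simp
      then show "isCont (\<lambda>t. measure N {z \<in> space N. - t < S z}) t"
        unfolding F' by (intro continuous_diff) auto
    qed
    have "((\<lambda>t. 1 - cdf (distr N borel S) (- t)) \<longlongrightarrow> 1 - 1) at_bot"
      by (intro tendsto_intros filterlim_compose[OF L.cdf_lim_at_top_prob] filterlim_uminus_at_top_at_bot)
    then show "((\<lambda>t. measure N {z \<in> space N. - t < S z}) \<longlongrightarrow> 0) at_bot"
      unfolding F' by simp
    have "((\<lambda>t. 1 - cdf (distr N borel S) (- t)) \<longlongrightarrow> 1 - 0) at_top"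
      by (intro tendsto_intros filterlim_compose[OF L.cdf_lim_at_bot] filterlim_uminus_at_bot_at_top)
    then show "((\<lambda>t. measure N {z \<in> space N. - t < S z}) \<longlongrightarrow> 1) at_top"
      unfolding F' by simp
  qed (use assms in auto)
  show thesis
  proof (rule that[of "E1 \<union> E2"])
    show "E1 \<union> E2 \<in> sets (PiM {1..m} (\<lambda>_. N))" using E1 E2 by simp
    show "measure (PiM {1..m} (\<lambda>_. N)) (E1 \<union> E2) \<le> 2 * exp (- 2 * real m * e\<^sup>2)"
      using measure_Un_le[OF E1(1) E2(1)] E1(2) E2(2) by linarith
    fix D t assume D: "D \<in> space (PiM {1..m} (\<lambda>_. N))"
      and dev: "e < \<bar>empirical_cdf m D S t - measure N {z \<in> space N. S z \<le> t}\<bar>"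
    have Di: "D i \<in> space N" if "i \<in> {1..m}" for i
      using D that by (auto simp: space_PiM)
    have le: "{i \<in> {1..m}. D i \<in> {z \<in> space N. S z \<le> t}} = {i \<in> {1..m}. S (D i) \<le> t}"
      using Di by auto
    \<comment> \<open>The strict inequality makes the two counts complementary: a score equal to
      \<open>t\<close> is counted on one side only.\<close>
    have gt: "{i \<in> {1..m}. D i \<in> {z \<in> space N. - (- t) < S z}} = {1..m} - {i \<in> {1..m}. S (D i) \<le> t}"
      using Di by auto
    have "card ({1..m} - {i \<in> {1..m}. S (D i) \<le> t}) = m - card {i \<in> {1..m}. S (D i) \<le> t}"
      by (subst card_Diff_subset) auto
    moreover have "{i \<in> {1..m}. S (D i) \<le> t} \<subseteq> {1..m}" by auto
    then have "card {i \<in> {1..m}. S (D i) \<le> t} \<le> m"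
      using card_mono[OF finite_atLeastAtMost, of _ 1 m] by simp
    ultimately have gt': "card {i \<in> {1..m}. D i \<in> {z \<in> space N. - (- t) < S z}} / m = 1 - empirical_cdf m D S t"
      unfolding gt empirical_cdf_eq using m by (simp add: diff_divide_distrib)
    have "measure N {z \<in> space N. - (- t) < S z} = 1 - measure N {z \<in> space N. S z \<le> t}"
      using F'[of "- t"] F[of t] by simp
    then have "D \<in> E1 \<or> D \<in> E2"
      using dev E1(3)[OF D, of t] E2(3)[OF D, of "- t"] unfolding gt' le empirical_cdf_eq [symmetric] by linarith
    then show "D \<in> E1 \<union> E2" by blast
  qed
qed

section \<open>Norms in \<open>L\<^sup>p\<close>\<close>

lemma Lp_norm_top_le_iff:
  assumes "g \<in> borel_measurable M" "0 \<le> a"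
  shows "Lp_norm \<top> M g \<le> ennreal a \<longleftrightarrow> (AE x in M. \<bar>g x\<bar> \<le> a)"
proof
  assume le: "Lp_norm \<top> M g \<le> ennreal a"
  have "AE x in M. ennreal \<bar>g x\<bar> \<le> esssup M (\<lambda>x. ennreal \<bar>g x\<bar>)" by (rule esssup_AE)
  then show "AE x in M. \<bar>g x\<bar> \<le> a"
  proof eventually_elim
    case (elim x)
    then have "ennreal \<bar>g x\<bar> \<le> ennreal a" using le by (simp add: Lp_norm_def)
    then show ?case using assms(2) by simp
  qed
next
  assume "AE x in M. \<bar>g x\<bar> \<le> a"
  then have "AE x in M. ennreal \<bar>g x\<bar> \<le> ennreal a" by eventually_elim (rule ennreal_leI)
  then show "Lp_norm \<top> M g \<le> ennreal a"
    using assms(1) unfolding Lp_norm_def by auto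
qed

text \<open>The unit-ball form of the norm: scaling by \<open>a\<close> removes the root of order
  \<open>P\<close> and leaves an integral to which convexity applies. The division by
  \<open>a\<close> is why later proofs enlarge their bounds by an arbitrary slack.\<close>

lemma Lp_norm_le_iff:
  assumes [measurable]: "g \<in> borel_measurable M" and a: "0 < a" and P: "1 \<le> P"
  shows "Lp_norm (ennreal P) M g \<le> ennreal a \<longleftrightarrow> (\<integral>\<^sup>+ x. ennreal ((\<bar>g x\<bar> / a) powr P) \<partial>M) \<le> 1"
proof -
  define I where "I = (\<integral>\<^sup>+ x. ennreal (\<bar>g x\<bar> powr P) \<partial>M)"
  have "(\<integral>\<^sup>+ x. ennreal ((\<bar>g x\<bar> / a) powr P) \<partial>M) = (\<integral>\<^sup>+ x. ennreal (1 / a powr P) * ennreal (\<bar>g x\<bar> powr P) \<partial>M)"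
    using a by (intro nn_integral_cong) (simp add: powr_divide ennreal_mult' [symmetric])
  also have "\<dots> = ennreal (1 / a powr P) * I"
    unfolding I_def by (rule nn_integral_cmult) measurable
  finally have eq: "(\<integral>\<^sup>+ x. ennreal ((\<bar>g x\<bar> / a) powr P) \<partial>M) = ennreal (1 / a powr P) * I" .
  have norm: "Lp_norm (ennreal P) M g = (if I = \<infinity> then \<infinity> else ennreal (enn2real I powr (1 / P)))"
    using P by (simp add: Lp_norm_def I_def Let_def)
  show ?thesis
  proof (cases I)
    case top
    then show ?thesis unfolding eq norm using a by (simp add: ennreal_mult_top top_unique)
  next
    case (real i)
    have "i powr (1 / P) \<le> a \<longleftrightarrow> i \<le> a powr P"
    proof
      assume "i powr (1 / P) \<le> a"
      then have "(i powr (1 / P)) powr P \<le> a powr P" using P by (intro powr_mono2) auto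
      then show "i \<le> a powr P" using real P by (simp add: powr_powr)
    next
      assume "i \<le> a powr P"
      then have "i powr (1 / P) \<le> (a powr P) powr (1 / P)" using real P by (intro powr_mono2) auto
      then show "i powr (1 / P) \<le> a" using a P by (simp add: powr_powr)
    qed
    moreover have "ennreal (1 / a powr P) * I \<le> 1 \<longleftrightarrow> i \<le> a powr P"
      using real a by (simp add: ennreal_mult' [symmetric])
    ultimately show ?thesis unfolding eq norm using real a by simp
  qed
qed

lemma ennreal_exponent_cases:
  assumes "1 \<le> (p :: ennreal)"
  obtains "p = \<top>" | P where "p = ennreal P" "1 \<le> P"
  using assms by (cases p) auto

lemma convex_on_powr:
  assumes "1 \<le> (P :: real)"
  shows "convex_on {0..} (\<lambda>x. x powr P)"
proof (rule convex_onI)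
  fix t x y :: real
  assume t: "0 < t" "t < 1" and xy: "x \<in> {0..}" "y \<in> {0..}"
  \<comment> \<open>As 0 to the power \<open>P\<close> is 0, convexity with one endpoint at 0
    reduces to s^P \<le> s for 0 < s < 1.\<close>
  have scale: "(s * z) powr P \<le> s * z powr P" if "0 < s" "s < 1" "0 \<le> z" for s z :: real
  proof -
    have "s powr P \<le> s powr 1" using that assms by (intro powr_mono') auto
    then show ?thesis using that by (simp add: powr_mult mult_right_mono)
  qed
  show "((1 - t) *\<^sub>R x + t *\<^sub>R y) powr P \<le> (1 - t) * x powr P + t * y powr P"
  proof (cases "x = 0 \<or> y = 0")
    case True
    then show ?thesis using scale[of t y] scale[of "1 - t" x] t xy by auto
  next
    case False
    then show ?thesis using convex_onD[OF powr_convex[OF assms], of t x y] t xy by auto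
  qed
qed simp

text \<open>Minkowski's inequality from the convexity of \<open>t \<mapsto> t\<^sup>p\<close>; the slack \<open>e\<close> allows dividing by \<open>a\<close> and \<open>b\<close>.\<close>

lemma Lp_norm_add_le:
  assumes p: "1 \<le> p" and [measurable]: "u \<in> borel_measurable M" "v \<in> borel_measurable M" "w \<in> borel_measurable M"
    and ab: "0 \<le> a" "0 \<le> b" "Lp_norm p M u \<le> ennreal a" "Lp_norm p M v \<le> ennreal b"
    and w: "AE x in M. \<bar>w x\<bar> \<le> \<bar>u x\<bar> + \<bar>v x\<bar>"
  shows "Lp_norm p M w \<le> ennreal (a + b)"
  using p
proof (cases rule: ennreal_exponent_cases)
  case 1
  then have "AE x in M. \<bar>u x\<bar> \<le> a" "AE x in M. \<bar>v x\<bar> \<le> b"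
    using ab by (simp_all add: Lp_norm_top_le_iff)
  with w have "AE x in M. \<bar>w x\<bar> \<le> a + b" by eventually_elim linarith
  then show ?thesis using 1 ab by (simp add: Lp_norm_top_le_iff del: ennreal_plus)
next
  case (2 P)
  show ?thesis
  proof (rule ennreal_le_epsilon)
    fix e :: real assume e: "0 < e"
    define a' where "a' = a + e / 2"
    define b' where "b' = b + e / 2"
    have pos: "0 < a'" "0 < b'" using ab e by (auto simp: a'_def b'_def)
    \<comment> \<open>The weight for which (|u| + |v|) / (a' + b') is a convex combination of |u| /
      a' and |v| / b'.\<close>
    define l where "l = b' / (a' + b')"
    have l: "0 \<le> l" "l \<le> 1" and l': "1 - l = a' / (a' + b')" using pos by (auto simp: l_def field_simps)
    have "Lp_norm p M u \<le> ennreal a'" "Lp_norm p M v \<le> ennreal b'"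
      by (rule order_trans[OF ab(3) ennreal_leI] order_trans[OF ab(4) ennreal_leI],
          use e in \<open>simp add: a'_def b'_def\<close>)+
    then have uv: "(\<integral>\<^sup>+ x. ennreal ((\<bar>u x\<bar> / a') powr P) \<partial>M) \<le> 1" "(\<integral>\<^sup>+ x. ennreal ((\<bar>v x\<bar> / b') powr P) \<partial>M) \<le> 1"
      using 2 pos by (simp_all add: Lp_norm_le_iff)
    have "(\<integral>\<^sup>+ x. ennreal ((\<bar>w x\<bar> / (a' + b')) powr P) \<partial>M)
        \<le> (\<integral>\<^sup>+ x. ennreal (1 - l) * ennreal ((\<bar>u x\<bar> / a') powr P) + ennreal l * ennreal ((\<bar>v x\<bar> / b') powr P) \<partial>M)"
    proof (rule nn_integral_mono_AE)
      show "AE x in M. ennreal ((\<bar>w x\<bar> / (a' + b')) powr P)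
          \<le> ennreal (1 - l) * ennreal ((\<bar>u x\<bar> / a') powr P) + ennreal l * ennreal ((\<bar>v x\<bar> / b') powr P)"
        using w
      proof eventually_elim
        case (elim x)
        have "(1 - l) * (\<bar>u x\<bar> / a') + l * (\<bar>v x\<bar> / b') = (\<bar>u x\<bar> + \<bar>v x\<bar>) / (a' + b')"
          unfolding l' unfolding l_def using pos by (simp add: add_divide_distrib)
        then have "\<bar>w x\<bar> / (a' + b') \<le> (1 - l) * (\<bar>u x\<bar> / a') + l * (\<bar>v x\<bar> / b')"
          using elim pos by (simp add: divide_right_mono)
        then have "(\<bar>w x\<bar> / (a' + b')) powr P \<le> ((1 - l) * (\<bar>u x\<bar> / a') + l * (\<bar>v x\<bar> / b')) powr P"
          using pos 2 by (intro powr_mono2) auto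
        also have "\<dots> \<le> (1 - l) * (\<bar>u x\<bar> / a') powr P + l * (\<bar>v x\<bar> / b') powr P"
          using convex_onD[OF convex_on_powr[OF 2(2)] l, of "\<bar>u x\<bar> / a'" "\<bar>v x\<bar> / b'"] pos by simp
        finally show ?case
          using l by (simp add: ennreal_mult' [symmetric] ennreal_plus [symmetric] del: ennreal_plus)
      qed
    qed
    also have "\<dots> = ennreal (1 - l) * (\<integral>\<^sup>+ x. ennreal ((\<bar>u x\<bar> / a') powr P) \<partial>M)
        + ennreal l * (\<integral>\<^sup>+ x. ennreal ((\<bar>v x\<bar> / b') powr P) \<partial>M)"
      by (simp add: nn_integral_add nn_integral_cmult)
    also have "\<dots> \<le> ennreal (1 - l) * 1 + ennreal l * 1"
      by (intro add_mono mult_left_mono uv) auto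
    also have "\<dots> = 1" using l by (simp add: ennreal_plus [symmetric] del: ennreal_plus)
    finally have "Lp_norm p M w \<le> ennreal (a' + b')" using 2 pos by (simp add: Lp_norm_le_iff del: ennreal_plus)
    moreover have "a' + b' = a + b + e" by (simp add: a'_def b'_def)
    ultimately show "Lp_norm p M w \<le> ennreal (a + b) + ennreal e"
      using ab e by (simp add: ennreal_plus [symmetric] del: ennreal_plus)
  qed
qed

lemma Lp_norm_cmult_le:
  assumes p: "1 \<le> p" and [measurable]: "u \<in> borel_measurable M" and "0 < k" "0 \<le> a" "Lp_norm p M u \<le> ennreal a"
  shows "Lp_norm p M (\<lambda>x. k * u x) \<le> ennreal (k * a)"
  using p
proof (cases rule: ennreal_exponent_cases)
  case 1
  then show ?thesis using assms by (simp add: Lp_norm_top_le_iff abs_mult)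
next
  case (2 P)
  show ?thesis
  proof (rule ennreal_le_epsilon)
    fix e :: real assume e: "0 < e"
    define a' where "a' = a + e / k"
    have a': "0 < a'" using assms e by (simp add: a'_def add_nonneg_pos)
    have "Lp_norm p M u \<le> ennreal a'"
      by (rule order_trans[OF assms(5) ennreal_leI]) (use e \<open>0 < k\<close> in \<open>simp add: a'_def\<close>)
    then have "Lp_norm p M (\<lambda>x. k * u x) \<le> ennreal (k * a')"
      using 2 a' \<open>0 < k\<close> by (simp add: Lp_norm_le_iff abs_mult)
    also have "k * a' = k * a + e" using \<open>0 < k\<close> by (simp add: a'_def field_simps)
    finally show "Lp_norm p M (\<lambda>x. k * u x) \<le> ennreal (k * a) + ennreal e"
      using assms e by (simp add: ennreal_plus [symmetric] del: ennreal_plus)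
  qed
qed

lemma (in prob_space) Lp_norm_const_le:
  assumes p: "1 \<le> p" and "0 \<le> c"
  shows "Lp_norm p M (\<lambda>_. c) \<le> ennreal c"
  using p
proof (cases rule: ennreal_exponent_cases)
  case (2 P)
  show ?thesis
  proof (cases "c = 0")
    case False
    then show ?thesis using 2 assms by (simp add: Lp_norm_le_iff emeasure_space_1)
  qed (use 2 in \<open>simp add: Lp_norm_def\<close>)
qed (simp add: assms Lp_norm_top_le_iff)

text \<open>Jensen's inequality, through the tangent of t^P at t = 1 taken at |u| / a'. Its two
  terms integrate to a' (1 - 1/P) and at most a'/P, which add up to a'.\<close>

lemma (in prob_space) nn_integral_le_Lp_norm:
  assumes p: "1 \<le> p" and [measurable]: "u \<in> borel_measurable M" and a: "0 \<le> a" and u: "Lp_norm p M u \<le> ennreal a"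
  shows "(\<integral>\<^sup>+ x. ennreal \<bar>u x\<bar> \<partial>M) \<le> ennreal a"
  using p
proof (cases rule: ennreal_exponent_cases)
  case 1
  then have "AE x in M. \<bar>u x\<bar> \<le> a" using u a by (simp add: Lp_norm_top_le_iff)
  then have "AE x in M. ennreal \<bar>u x\<bar> \<le> ennreal a" by eventually_elim (rule ennreal_leI)
  then have "(\<integral>\<^sup>+ x. ennreal \<bar>u x\<bar> \<partial>M) \<le> (\<integral>\<^sup>+ x. ennreal a \<partial>M)" by (rule nn_integral_mono_AE)
  then show ?thesis by (simp add: emeasure_space_1)
next
  case (2 P)
  show ?thesis
  proof (rule ennreal_le_epsilon)
    fix e :: real assume e: "0 < e"
    define a' where "a' = a + e"
    have a': "0 < a'" using a e by (simp add: a'_def)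
    have "Lp_norm p M u \<le> ennreal a'"
      by (rule order_trans[OF u ennreal_leI]) (use e in \<open>simp add: a'_def\<close>)
    then have I: "(\<integral>\<^sup>+ x. ennreal ((\<bar>u x\<bar> / a') powr P) \<partial>M) \<le> 1" using 2 a' by (simp add: Lp_norm_le_iff)
    have tangent: "y \<le> a' * (1 - 1 / P) + a' / P * (y / a') powr P" if "0 \<le> y" for y
    proof -
      have "P * (y / a' - 1) \<le> (y / a') powr P - 1 powr P"
      proof (cases "y = 0")
        case False
        then show ?thesis using that a' 2
          by (intro convex_on_imp_above_tangent[OF powr_convex[OF 2(2)]])
             (auto intro!: derivative_eq_intros simp: interior_open)
      qed (use 2 in simp)
      then have "P * (y / a') \<le> P - 1 + (y / a') powr P" by (simp add: algebra_simps)
      then have "a' / P * (P * (y / a')) \<le> a' / P * (P - 1 + (y / a') powr P)"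
        using 2 a' by (intro mult_left_mono) auto
      also have "a' / P * (P * (y / a')) = y" using 2 a' by simp
      also have "a' / P * (P - 1 + (y / a') powr P) = a' * (1 - 1 / P) + a' / P * (y / a') powr P"
        using 2 by (simp add: distrib_left right_diff_distrib)
      finally show ?thesis .
    qed
    have "(\<integral>\<^sup>+ x. ennreal \<bar>u x\<bar> \<partial>M)
        \<le> (\<integral>\<^sup>+ x. ennreal (a' * (1 - 1 / P)) + ennreal (a' / P) * ennreal ((\<bar>u x\<bar> / a') powr P) \<partial>M)"
      using tangent 2 a' by (intro nn_integral_mono) (simp add: ennreal_mult' [symmetric] ennreal_plus [symmetric] del: ennreal_plus)
    also have "\<dots> = ennreal (a' * (1 - 1 / P)) + ennreal (a' / P) * (\<integral>\<^sup>+ x. ennreal ((\<bar>u x\<bar> / a') powr P) \<partial>M)"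
      by (simp add: nn_integral_add nn_integral_cmult emeasure_space_1)
    also have "\<dots> \<le> ennreal (a' * (1 - 1 / P)) + ennreal (a' / P) * 1"
      by (intro add_left_mono mult_left_mono I) auto
    also have "\<dots> = ennreal (a' * (1 - 1 / P) + a' / P)"
      using 2 a' by simp
    also have "a' * (1 - 1 / P) + a' / P = a + e"
      by (simp add: a'_def right_diff_distrib)
    finally show "(\<integral>\<^sup>+ x. ennreal \<bar>u x\<bar> \<partial>M) \<le> ennreal a + ennreal e" using a e by simp
  qed
qed

section \<open>Conditional laws and coverage\<close>

context real_distribution
begin

lemma cdf_surj:
  assumes cont: "\<And>t. isCont (cdf M) t" and v: "0 < v" "v < 1"
  obtains x where "cdf M x = v"
proof -
  have "eventually (\<lambda>t. cdf M t < v) at_bot" "eventually (\<lambda>t. v < cdf M t) at_top"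
    using order_tendstoD(2)[OF cdf_lim_at_bot] order_tendstoD(1)[OF cdf_lim_at_top_prob] v by auto
  then obtain a b where ab: "cdf M a < v" "v < cdf M b"
    by (auto simp: eventually_at_bot_linorder eventually_at_top_linorder)
  then have "a \<le> b" using cdf_nondecreasing[of b a] by force
  then show thesis using IVT[of "cdf M" a v b] ab cont that by auto
qed

text \<open>Right continuity makes the infimum a minimum. The equivalence also turns sublevel sets
  of the quantile into conditions on the CDF at one point, from which measurability in
  \<open>x\<close> follows.\<close>

lemma quantile_le_iff:
  assumes \<tau>: "0 < \<tau>" "\<tau> < 1"
  shows "Inf {t. \<tau> \<le> cdf M t} \<le> t \<longleftrightarrow> \<tau> \<le> cdf M t"
proof -
  have "eventually (\<lambda>t. cdf M t < \<tau>) at_bot" "eventually (\<lambda>t. \<tau> < cdf M t) at_top"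
    using order_tendstoD(2)[OF cdf_lim_at_bot] order_tendstoD(1)[OF cdf_lim_at_top_prob] \<tau> by auto
  then obtain a b where ab: "cdf M a < \<tau>" "\<tau> < cdf M b"
    by (auto simp: eventually_at_bot_linorder eventually_at_top_linorder)
  have bdd: "bdd_below {t. \<tau> \<le> cdf M t}"
  proof (rule bdd_belowI)
    fix t assume "t \<in> {t. \<tau> \<le> cdf M t}"
    then show "a \<le> t" using ab(1) cdf_nondecreasing[of t a] by force
  qed
  have ne: "{t. \<tau> \<le> cdf M t} \<noteq> {}" using ab(2) by (auto intro: less_imp_le)
  show ?thesis
  proof
    assume le: "Inf {t. \<tau> \<le> cdf M t} \<le> t"
    have "eventually (\<lambda>s. \<tau> \<le> cdf M s) (at_right t)"
      unfolding eventually_at_right_field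
    proof (intro exI[of _ "t + 1"] conjI allI impI)
      fix s assume "t < s"
      then obtain r where "\<tau> \<le> cdf M r" "r < s" using le cInf_lessD[OF ne, of s] by auto
      then show "\<tau> \<le> cdf M s" using cdf_nondecreasing[of r s] by simp
    qed simp
    moreover have "(cdf M \<longlongrightarrow> cdf M t) (at_right t)"
      using cdf_is_right_cont[of t] by (simp add: continuous_within)
    ultimately show "\<tau> \<le> cdf M t" by (intro tendsto_lowerbound) auto
  qed (use bdd in \<open>auto intro: cInf_lower\<close>)
qed

lemma cdf_quantile:
  assumes cont: "\<And>t. isCont (cdf M) t" and \<tau>: "0 < \<tau>" "\<tau> < 1"
  shows "cdf M (Inf {t. \<tau> \<le> cdf M t}) = \<tau>"
proof -
  obtain x where x: "cdf M x = \<tau>" using cdf_surj[OF assms] .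
  then have "Inf {t. \<tau> \<le> cdf M t} \<le> x" by (simp add: quantile_le_iff[OF \<tau>])
  then show ?thesis using quantile_le_iff[OF \<tau>] cdf_nondecreasing x by (metis order_antisym order_refl)
qed

end

text \<open>Rearrangement for two points: towards sorted targets, sorting does not increase the
  total error. Hence sorting costs no constant in the final bound.\<close>

lemma sorted_endpoints_l1:
  fixes a b a' b' :: real
  assumes "a' \<le> b'"
  shows "\<bar>min a b - a'\<bar> + \<bar>max a b - b'\<bar> \<le> \<bar>a - a'\<bar> + \<bar>b - b'\<bar>"
  using assms by (auto simp: min_def max_def abs_if)

section \<open>Coverage of shifted intervals under one conditional law\<close>

locale regular_conditional_law = real_distribution \<nu> for \<nu> +
  fixes \<alpha> \<mu>low \<mu>up r0 a b :: real
  assumes \<alpha>: "0 < \<alpha>" "\<alpha> < 1" and \<mu>: "0 < \<mu>low" "0 < \<mu>up"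
    and upper: "\<And>u v. u \<le> v \<Longrightarrow> measure \<nu> {u..v} \<le> \<mu>up * (v - u)"
    and a_def: "a = Inf {t. \<alpha> / 2 \<le> cdf \<nu> t}" and b_def: "b = Inf {t. 1 - \<alpha> / 2 \<le> cdf \<nu> t}"
    and a_lower: "\<And>h. 0 \<le> h \<Longrightarrow> h \<le> r0 \<Longrightarrow> \<mu>low * h \<le> measure \<nu> {a - h..a} \<and> \<mu>low * h \<le> measure \<nu> {a..a + h}"
    and b_lower: "\<And>h. 0 \<le> h \<Longrightarrow> h \<le> r0 \<Longrightarrow> \<mu>low * h \<le> measure \<nu> {b - h..b} \<and> \<mu>low * h \<le> measure \<nu> {b..b + h}"
begin

lemma atomless: "measure \<nu> {t} = 0"
  using upper[of t t] by (simp add: antisym)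

lemma isCont_cdf': "isCont (cdf \<nu>) t"
  by (simp add: isCont_cdf atomless)

text \<open>The positive part covers reversed intervals, which occur when a negative inflation
  empties the interval. Clipping at 0 is 1-Lipschitz, so bounds on CDF increments carry over to
  coverage.\<close>

lemma measure_Icc: "measure \<nu> {u..v} = max 0 (cdf \<nu> v - cdf \<nu> u)"
proof (cases "u \<le> v")
  case True
  have "{u..v} = {u} \<union> {u<..v}" using True by auto
  then have "measure \<nu> {u..v} \<le> measure \<nu> {u} + measure \<nu> {u<..v}"
    using measure_Un_le[of "{u}" \<nu> "{u<..v}"] by simp
  moreover have "measure \<nu> {u<..v} \<le> measure \<nu> {u..v}" by (intro finite_measure_mono) auto
  moreover have "measure \<nu> {u<..v} = cdf \<nu> v - cdf \<nu> u" if "u < v" using cdf_diff_eq[OF that] by simp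
  ultimately show ?thesis using atomless True cdf_nondecreasing[OF True] by (cases "u = v") auto
next
  case False
  then show ?thesis using cdf_nondecreasing[of v u] by (simp add: max_def)
qed

lemma cdf_lipschitz: "\<bar>cdf \<nu> u - cdf \<nu> v\<bar> \<le> \<mu>up * \<bar>u - v\<bar>"
proof -
  have *: "\<bar>cdf \<nu> u - cdf \<nu> v\<bar> \<le> \<mu>up * \<bar>u - v\<bar>" if "u \<le> v" for u v
    using that upper[OF that] cdf_nondecreasing[OF that] by (simp add: measure_Icc abs_if)
  show ?thesis using *[of u v] *[of v u] by (cases "u \<le> v") (auto simp: abs_minus_commute)
qed

lemma cdf_endpoints: "cdf \<nu> a = \<alpha> / 2" "cdf \<nu> b = 1 - \<alpha> / 2"
  unfolding a_def b_def by (rule cdf_quantile[OF isCont_cdf'], use \<alpha> in simp, use \<alpha> in simp)+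

lemma endpoint_gap: "(1 - \<alpha>) / \<mu>up \<le> b - a" "a \<le> b"
proof -
  show "a \<le> b"
  proof (rule ccontr)
    assume "\<not> a \<le> b"
    then show False using cdf_nondecreasing[of b a] cdf_endpoints \<alpha> by simp
  qed
  then have "1 - \<alpha> \<le> \<mu>up * (b - a)" using cdf_lipschitz[of b a] cdf_endpoints \<alpha> by simp
  then show "(1 - \<alpha>) / \<mu>up \<le> b - a" using \<mu> by (simp add: divide_le_eq mult.commute)
qed

lemma coverage_perturbation:
  "\<bar>measure \<nu> {l - t..u + t} - measure \<nu> {a - t..b + t}\<bar> \<le> \<mu>up * (\<bar>l - a\<bar> + \<bar>u - b\<bar>)"
  unfolding measure_Icc distrib_left using cdf_lipschitz[of "l - t" "a - t"] cdf_lipschitz[of "u + t" "b + t"]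
  by (auto simp: max_def abs_if split: if_splits)

lemma coverage_inflation: "\<bar>measure \<nu> {a - t..b + t} - (1 - \<alpha>)\<bar> \<le> 2 * \<mu>up * \<bar>t\<bar>"
  unfolding measure_Icc using cdf_lipschitz[of "a - t" a] cdf_lipschitz[of "b + t" b] cdf_endpoints \<alpha>
  by (auto simp: max_def abs_if split: if_splits)

lemma coverage_growth:
  assumes "0 \<le> h" "h \<le> r0"
  shows "1 - \<alpha> + 2 * \<mu>low * h \<le> measure \<nu> {a - h..b + h}"
  using a_lower[OF assms] b_lower[OF assms] cdf_endpoints \<mu> assms
    cdf_nondecreasing[of "a - h" a] cdf_nondecreasing[of b "b + h"]
  by (auto simp: measure_Icc max_def split: if_splits)

text \<open>Shrinking removes one strip of mass at least \<mu>low h at each endpoint, provided that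
  the strips do not overlap. Mass 1 - \<alpha> at density at most \<mu>up needs length (1 -
  \<alpha>) / \<mu>up, hence the second term in \<open>r_minus\<close>.\<close>

lemma coverage_decay:
  assumes "0 \<le> h" "h \<le> r0" "h \<le> (1 - \<alpha>) / (2 * \<mu>up)"
  shows "measure \<nu> {a + h..b - h} \<le> 1 - \<alpha> - 2 * \<mu>low * h"
proof -
  have "2 * h \<le> b - a" using assms(3) endpoint_gap(1) by simp
  then have "cdf \<nu> (a + h) \<le> cdf \<nu> (b - h)" by (intro cdf_nondecreasing) simp
  then show ?thesis
    using a_lower[OF assms(1,2)] b_lower[OF assms(1,2)] cdf_endpoints assms
      cdf_nondecreasing[of a "a + h"] cdf_nondecreasing[of "b - h" b]
    by (auto simp: measure_Icc max_def split: if_splits)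
qed

end

section \<open>The joint law and averages of conditional coverage\<close>

locale conditional_model = X: prob_space PX for PX :: "'a measure" +
  fixes K :: "'a \<Rightarrow> real measure"
  assumes K_measurable [measurable]: "K \<in> PX \<rightarrow>\<^sub>M prob_algebra borel"
begin

lemma real_distribution_K:
  assumes "x \<in> space PX"
  shows "real_distribution (K x)"
proof -
  have "K x \<in> space (prob_algebra borel)" using measurable_space[OF K_measurable assms] .
  then show ?thesis
    by (auto simp: space_prob_algebra real_distribution_def real_distribution_axioms_def)
qed

lemma joint_kernel_measurable:
  "(\<lambda>x. K x \<bind> (\<lambda>y. return (PX \<Otimes>\<^sub>M borel) (x, y))) \<in> PX \<rightarrow>\<^sub>M prob_algebra (PX \<Otimes>\<^sub>M borel)"
  by measurable

lemma in_space_prob_algebra_self: "PX \<in> space (prob_algebra PX)"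
  by (simp add: space_prob_algebra X.prob_space_axioms)

lemma sets_joint_law [measurable_cong]: "sets (joint_law PX K) = sets (PX \<Otimes>\<^sub>M borel)"
  unfolding joint_law_def by (rule sets_bind'[OF in_space_prob_algebra_self joint_kernel_measurable])

lemma space_joint_law: "space (joint_law PX K) = space PX \<times> UNIV"
  using sets_eq_imp_space_eq[OF sets_joint_law] by (simp add: space_pair_measure)

lemma prob_space_joint_law: "prob_space (joint_law PX K)"
  unfolding joint_law_def by (rule prob_space_bind'[OF in_space_prob_algebra_self joint_kernel_measurable])

lemma emeasure_joint_law:
  assumes [measurable]: "X \<in> sets (PX \<Otimes>\<^sub>M borel)"
  shows "emeasure (joint_law PX K) X = (\<integral>\<^sup>+ x. emeasure (K x) (Pair x -` X) \<partial>PX)"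
proof -
  have "emeasure (joint_law PX K) X = (\<integral>\<^sup>+ x. emeasure (K x \<bind> (\<lambda>y. return (PX \<Otimes>\<^sub>M borel) (x, y))) X \<partial>PX)"
    unfolding joint_law_def
    by (rule emeasure_bind_prob_algebra[OF in_space_prob_algebra_self joint_kernel_measurable assms])
  also have "\<dots> = (\<integral>\<^sup>+ x. emeasure (K x) (Pair x -` X) \<partial>PX)"
  proof (rule nn_integral_cong)
    fix x assume x [measurable]: "x \<in> space PX"
    interpret R: real_distribution "K x" by (rule real_distribution_K[OF x])
    have "emeasure (K x \<bind> (\<lambda>y. return (PX \<Otimes>\<^sub>M borel) (x, y))) X
        = (\<integral>\<^sup>+ y. emeasure (return (PX \<Otimes>\<^sub>M borel) (x, y)) X \<partial>K x)"
    proof (rule emeasure_bind_prob_algebra)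
      show "K x \<in> space (prob_algebra borel)" using measurable_space[OF K_measurable x] .
      show "(\<lambda>y. return (PX \<Otimes>\<^sub>M borel) (x, y)) \<in> borel \<rightarrow>\<^sub>M prob_algebra (PX \<Otimes>\<^sub>M borel)"
        by measurable
    qed fact
    also have "\<dots> = (\<integral>\<^sup>+ y. indicator (Pair x -` X) y \<partial>K x)"
      by (intro nn_integral_cong) (simp add: indicator_def)
    also have "\<dots> = emeasure (K x) (Pair x -` X)"
      using sets_Pair1[OF assms, of x] by (intro nn_integral_indicator) simp
    finally show "emeasure (K x \<bind> (\<lambda>y. return (PX \<Otimes>\<^sub>M borel) (x, y))) X = emeasure (K x) (Pair x -` X)" .
  qed
  finally show ?thesis .
qed

lemma measurable_slice:
  assumes "X \<in> sets (PX \<Otimes>\<^sub>M borel)"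
  shows "(\<lambda>x. measure (K x) (Pair x -` X)) \<in> borel_measurable PX"
proof (rule measure_measurable_prob_algebra2[OF _ K_measurable])
  have "Sigma (space PX) (\<lambda>x. Pair x -` X) = X"
    using sets.sets_into_space[OF assms] by (auto simp: space_pair_measure)
  then show "Sigma (space PX) (\<lambda>x. Pair x -` X) \<in> sets (PX \<Otimes>\<^sub>M borel)" using assms by simp
qed

lemma measure_K_le_1: "x \<in> space PX \<Longrightarrow> measure (K x) X \<le> 1"
  using real_distribution_K[of x] by (simp add: real_distribution_def prob_space.prob_le_1)

lemma integrable_measure_K:
  assumes "(\<lambda>x. measure (K x) (A x)) \<in> borel_measurable PX"
  shows "integrable PX (\<lambda>x. measure (K x) (A x))"
  using assms by (intro X.integrable_const_bound[where B = 1]) (auto simp: measure_K_le_1)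

lemma measure_joint_law:
  assumes X: "X \<in> sets (PX \<Otimes>\<^sub>M borel)"
  shows "measure (joint_law PX K) X = (\<integral> x. measure (K x) (Pair x -` X) \<partial>PX)"
proof -
  have "emeasure (joint_law PX K) X = (\<integral>\<^sup>+ x. ennreal (measure (K x) (Pair x -` X)) \<partial>PX)"
    unfolding emeasure_joint_law[OF X] using real_distribution_K
    by (intro nn_integral_cong)
       (simp add: real_distribution_def prob_space_def finite_measure.emeasure_eq_measure)
  also have "\<dots> = ennreal (\<integral> x. measure (K x) (Pair x -` X) \<partial>PX)"
    by (intro nn_integral_eq_integral integrable_measure_K measurable_slice X) auto
  finally show ?thesis by (simp add: measure_def integral_nonneg_AE)
qed

lemma measurable_cond_quantile:
  assumes "0 < \<tau>" "\<tau> < 1"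
  shows "cond_quantile K \<tau> \<in> borel_measurable PX"
proof (rule borel_measurable_iff_le[THEN iffD2], intro allI)
  fix t
  have "{x \<in> space PX. cond_quantile K \<tau> x \<le> t} = {x \<in> space PX. \<tau> \<le> measure (K x) {..t}}"
    using real_distribution.quantile_le_iff[OF real_distribution_K assms]
    by (auto simp: cond_quantile_def cdf_def)
  moreover have "{x \<in> space PX. \<tau> \<le> measure (K x) {..t}} \<in> sets PX" by measurable
  ultimately show "{x \<in> space PX. cond_quantile K \<tau> x \<le> t} \<in> sets PX" by simp
qed

text \<open>An interval with moving endpoints is a section of a measurable subset of the product.
  The base \<open>N\<close> is general because the map is needed both over \<open>PX\<close> and
  over pairs of a training sample and a point.\<close>

lemma measurable_coverage:
  fixes L :: "'b \<Rightarrow> real measure" and lo hi :: "'b \<Rightarrow> real"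
  assumes [measurable]: "L \<in> N \<rightarrow>\<^sub>M prob_algebra borel" "lo \<in> borel_measurable N" "hi \<in> borel_measurable N"
  shows "(\<lambda>x. measure (L x) {lo x..hi x}) \<in> borel_measurable N"
proof (rule measure_measurable_prob_algebra2)
  have "{z \<in> space (N \<Otimes>\<^sub>M borel). lo (fst z) \<le> snd z \<and> snd z \<le> hi (fst z)} \<in> sets (N \<Otimes>\<^sub>M borel)"
    by measurable
  moreover have "Sigma (space N) (\<lambda>x. {lo x..hi x}) = {z \<in> space (N \<Otimes>\<^sub>M borel). lo (fst z) \<le> snd z \<and> snd z \<le> hi (fst z)}"
    by (auto simp: space_pair_measure)
  ultimately show "Sigma (space N) (\<lambda>x. {lo x..hi x}) \<in> sets (N \<Otimes>\<^sub>M borel)" by simp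
qed fact

text \<open>The least signed inflation \<open>t\<close> for which \<open>y\<close> lies in
  \<open>{lo x - t..hi x + t}\<close>; for \<open>lo x < hi x\<close> it is negative in the interior
  of the interval.\<close>

definition interval_score :: "('a \<Rightarrow> real) \<Rightarrow> ('a \<Rightarrow> real) \<Rightarrow> 'a \<times> real \<Rightarrow> real" where
  "interval_score lo hi = (\<lambda>(x, y). max (lo x - y) (y - hi x))"

lemma interval_score_le_iff: "interval_score lo hi (x, y) \<le> t \<longleftrightarrow> y \<in> {lo x - t..hi x + t}"
  by (auto simp: interval_score_def)

lemma interval_score_measurable [measurable]:
  assumes [measurable]: "lo \<in> borel_measurable PX" "hi \<in> borel_measurable PX"
  shows "interval_score lo hi \<in> borel_measurable (PX \<Otimes>\<^sub>M borel)"
  unfolding interval_score_def by measurable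

lemma score_cdf_eq:
  assumes [measurable]: "lo \<in> borel_measurable PX" "hi \<in> borel_measurable PX"
  shows "score_cdf PX K (interval_score lo hi) t = (\<integral> x. measure (K x) {lo x - t..hi x + t} \<partial>PX)"
proof -
  have "{z \<in> space (PX \<Otimes>\<^sub>M borel). interval_score lo hi z \<le> t} \<in> sets (PX \<Otimes>\<^sub>M borel)" by measurable
  moreover have "Pair x -` {z \<in> space (PX \<Otimes>\<^sub>M borel). interval_score lo hi z \<le> t} = {lo x - t..hi x + t}"
    if "x \<in> space PX" for x
    using that by (auto simp: space_pair_measure interval_score_le_iff)
  ultimately show ?thesis
    unfolding score_cdf_def sets_eq_imp_space_eq[OF sets_joint_law]
    by (subst measure_joint_law) (auto intro: Bochner_Integration.integral_cong)
qed

end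

section \<open>The deterministic coverage bound under mass regularity\<close>

locale regular_model = conditional_model PX K for PX :: "'a measure" and K +
  fixes \<alpha> \<mu>low \<mu>up r0 :: real
  assumes \<alpha>: "0 < \<alpha>" "\<alpha> < 1" and regularity: "mass_regularity PX K \<alpha> \<mu>low \<mu>up r0"
begin

lemma constants_pos: "0 < \<mu>low" "0 < \<mu>up" "0 < r0"
  using regularity by (auto simp: mass_regularity_def)

abbreviation "q1 \<equiv> cond_quantile K (\<alpha> / 2)"
abbreviation "q2 \<equiv> cond_quantile K (1 - \<alpha> / 2)"

lemma measurable_quantiles [measurable]: "q1 \<in> borel_measurable PX" "q2 \<in> borel_measurable PX"
  using \<alpha> by (simp_all add: measurable_cond_quantile)

lemma AE_regular: "AE x in PX. regular_conditional_law (K x) \<alpha> \<mu>low \<mu>up r0 (q1 x) (q2 x)"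
proof -
  from regularity obtain X0 where X0: "X0 \<in> sets PX" "measure PX X0 = 1"
    and reg: "\<forall>x\<in>X0. (\<forall>u v. u \<le> v \<longrightarrow> measure (K x) {u..v} \<le> \<mu>up * (v - u)) \<and>
        (\<forall>\<tau>\<in>{\<alpha>/2, 1 - \<alpha>/2}. \<forall>h. 0 \<le> h \<and> h \<le> r0 \<longrightarrow>
          measure (K x) {cond_quantile K \<tau> x - h .. cond_quantile K \<tau> x} \<ge> \<mu>low * h \<and>
          measure (K x) {cond_quantile K \<tau> x .. cond_quantile K \<tau> x + h} \<ge> \<mu>low * h)"
    unfolding mass_regularity_def by (elim conjE bexE)
  have "AE x in PX. x \<in> X0" using X0 by (simp add: X.prob_eq_1)
  then show ?thesis
  proof (rule AE_mp, intro AE_I2 impI)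
    fix x assume x: "x \<in> space PX" "x \<in> X0"
    interpret R: real_distribution "K x" by (rule real_distribution_K[OF x(1)])
    show "regular_conditional_law (K x) \<alpha> \<mu>low \<mu>up r0 (q1 x) (q2 x)"
      by unfold_locales (use bspec[OF reg x(2)] \<alpha> constants_pos in \<open>auto simp: cond_quantile_def\<close>)
  qed
qed

text \<open>On a fibre the score equals \<open>t\<close> at most at \<open>lo x - t\<close> and
  \<open>hi x + t\<close>, both null by the upper mass bound. This supplies the continuity on which
  the DKW argument rests.\<close>

lemma score_atomless:
  assumes [measurable]: "lo \<in> borel_measurable PX" "hi \<in> borel_measurable PX"
  shows "measure (joint_law PX K) {z \<in> space (joint_law PX K). interval_score lo hi z = t} = 0"
proof -
  let ?X = "{z \<in> space (PX \<Otimes>\<^sub>M borel). interval_score lo hi z = t}"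
  have "?X \<in> sets (PX \<Otimes>\<^sub>M borel)" by measurable
  then have "measure (joint_law PX K) ?X = (\<integral> x. measure (K x) (Pair x -` ?X) \<partial>PX)"
    by (rule measure_joint_law)
  also have "\<dots> = (\<integral> x. 0 \<partial>PX)"
  proof (rule integral_cong_AE)
    show "AE x in PX. measure (K x) (Pair x -` ?X) = 0"
      using AE_regular
    proof eventually_elim
      case (elim x)
      interpret R: regular_conditional_law "K x" \<alpha> \<mu>low \<mu>up r0 "q1 x" "q2 x" by fact
      have "Pair x -` ?X \<subseteq> {lo x - t} \<union> {hi x + t}"
        by (auto simp: interval_score_def max_def split: if_splits)
      then have "measure (K x) (Pair x -` ?X) \<le> measure (K x) ({lo x - t} \<union> {hi x + t})"
        by (intro R.finite_measure_mono) auto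
      also have "\<dots> \<le> measure (K x) {lo x - t} + measure (K x) {hi x + t}"
        by (rule measure_Un_le) auto
      finally show ?case using measure_nonneg[of "K x" "Pair x -` ?X"] by (simp add: R.atomless del: measure_nonneg)
    qed
  qed (use measurable_slice[OF \<open>?X \<in> _\<close>] in simp_all)
  finally show ?thesis by (simp add: sets_eq_imp_space_eq[OF sets_joint_law])
qed

text \<open>Everything random is frozen: \<open>H\<close> stands for the empirical CDF and
  \<open>s\<close> for the excess of the conformal level. The endpoint error enters twice, in mean
  to locate the threshold and in norm for the error on the fibres, whence the factor 1 + \<mu>up /
  \<mu>low.\<close>

lemma Lp_norm_coverage_error_le:
  fixes u v :: "'a \<Rightarrow> real" and H :: "real \<Rightarrow> real"
  assumes p: "1 \<le> p" and uv [measurable]: "u \<in> borel_measurable PX" "v \<in> borel_measurable PX"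
    and \<epsilon>: "0 \<le> \<epsilon>" "Lp_norm p PX (\<lambda>x. u x - q1 x) \<le> ennreal \<epsilon>" "Lp_norm p PX (\<lambda>x. v x - q2 x) \<le> ennreal \<epsilon>"
    and \<eta>: "0 \<le> \<eta>" and s: "0 < s"
    and small: "2 * \<mu>up * \<epsilon> + \<eta> \<le> 2 * \<mu>low * r_minus \<alpha> \<mu>up r0"
      "2 * \<mu>up * \<epsilon> + \<eta> + s \<le> 2 * \<mu>low * r_plus r0"
    and S: "S = interval_score (\<lambda>x. min (u x) (v x)) (\<lambda>x. max (u x) (v x))"
    and H: "mono H" "\<And>t. \<bar>H t - score_cdf PX K S t\<bar> \<le> \<eta>"
  shows "Lp_norm p PX (\<lambda>x. measure (K x) {y. ereal (S (x, y)) \<le> gen_inverse (1 - \<alpha> + s) H} - (1 - \<alpha>))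
    \<le> ennreal (2 * \<mu>up * (1 + \<mu>up / \<mu>low) * \<epsilon> + \<mu>up / \<mu>low * (\<eta> + s))"
proof -
  define lo where "lo x = min (u x) (v x)" for x
  define hi where "hi x = max (u x) (v x)" for x
  have [measurable]: "lo \<in> borel_measurable PX" "hi \<in> borel_measurable PX"
    unfolding lo_def hi_def by measurable
  have S': "S = interval_score lo hi" unfolding S lo_def hi_def ..
  define d where "d x = \<bar>u x - q1 x\<bar> + \<bar>v x - q2 x\<bar>" for x
  have [measurable]: "d \<in> borel_measurable PX" unfolding d_def by measurable
  have d: "Lp_norm p PX d \<le> ennreal (\<epsilon> + \<epsilon>)"
    by (rule Lp_norm_add_le[OF p _ _ _ \<epsilon>(1,1,2,3)]) (auto simp: d_def)
  have d_nonneg: "0 \<le> d x" for x by (simp add: d_def)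
  have nn_d: "(\<integral>\<^sup>+ x. ennreal (d x) \<partial>PX) \<le> ennreal (2 * \<epsilon>)"
    using X.nn_integral_le_Lp_norm[OF p _ _ d] \<epsilon>(1) d_nonneg by simp
  have int_d: "integrable PX d"
    using nn_d d_nonneg by (intro integrableI_nonneg) (auto intro: le_less_trans)
  have "ennreal (\<integral> x. d x \<partial>PX) \<le> ennreal (2 * \<epsilon>)"
    using nn_d nn_integral_eq_integral[OF int_d] d_nonneg by simp
  then have I_d: "(\<integral> x. d x \<partial>PX) \<le> 2 * \<epsilon>" using \<epsilon>(1) by simp
  define cov where "cov t x = measure (K x) {lo x - t..hi x + t}" for t x
  define cov0 where "cov0 t x = measure (K x) {q1 x - t..q2 x + t}" for t x
  have [measurable]: "cov t \<in> borel_measurable PX" "cov0 t \<in> borel_measurable PX" for t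
    unfolding cov_def cov0_def by (auto intro!: measurable_coverage)
  have int: "integrable PX (cov t)" "integrable PX (cov0 t)" for t
    unfolding cov_def cov0_def by (auto intro!: integrable_measure_K measurable_coverage)
  have close: "AE x in PX. \<bar>cov t x - cov0 t x\<bar> \<le> \<mu>up * d x" for t
    using AE_regular
  proof eventually_elim
    case (elim x)
    interpret R: regular_conditional_law "K x" \<alpha> \<mu>low \<mu>up r0 "q1 x" "q2 x" by fact
    have "\<bar>cov t x - cov0 t x\<bar> \<le> \<mu>up * (\<bar>lo x - q1 x\<bar> + \<bar>hi x - q2 x\<bar>)"
      unfolding cov_def cov0_def by (rule R.coverage_perturbation)
    also have "\<dots> \<le> \<mu>up * d x"
      unfolding lo_def hi_def d_def using constants_pos
      by (intro mult_left_mono sorted_endpoints_l1 R.endpoint_gap(2)) auto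
    finally show ?case .
  qed
  \<comment> \<open>The oracle counterpart of the score CDF: the lower mass bound gives its growth
    around \<open>t = 0\<close>, while the fitted endpoints inherit it only up to an error.\<close>
  define G where "G t = (\<integral> x. cov0 t x \<partial>PX)" for t
  have F: "score_cdf PX K S t = (\<integral> x. cov t x \<partial>PX)" for t
    unfolding S' cov_def by (rule score_cdf_eq) measurable
  have FG: "\<bar>score_cdf PX K S t - G t\<bar> \<le> 2 * \<mu>up * \<epsilon>" for t
  proof -
    have "\<bar>score_cdf PX K S t - G t\<bar> = \<bar>\<integral> x. cov t x - cov0 t x \<partial>PX\<bar>"
      unfolding F G_def using int by simp
    also have "\<dots> \<le> (\<integral> x. \<bar>cov t x - cov0 t x\<bar> \<partial>PX)" by (rule integral_abs_bound)
    also have "\<dots> \<le> (\<integral> x. \<mu>up * d x \<partial>PX)"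
      using int int_d close by (intro integral_mono_AE) auto
    also have "\<dots> \<le> \<mu>up * (2 * \<epsilon>)"
      using I_d constants_pos by (simp add: mult_left_mono)
    finally show ?thesis by (simp add: mult_ac)
  qed
  have grow: "1 - \<alpha> + 2 * \<mu>low * h \<le> G h" if "0 \<le> h" "h \<le> r0" for h
    unfolding G_def
  proof (rule X.integral_ge_const[OF int(2)])
    show "AE x in PX. 1 - \<alpha> + 2 * \<mu>low * h \<le> cov0 h x"
      using AE_regular by eventually_elim
        (unfold cov0_def, rule regular_conditional_law.coverage_growth[OF _ that])
  qed
  have decay: "G (- h) \<le> 1 - \<alpha> - 2 * \<mu>low * h" if "0 \<le> h" "h \<le> r_minus \<alpha> \<mu>up r0" for h
    unfolding G_def
  proof (rule X.integral_le_const[OF int(2)])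
    show "AE x in PX. cov0 (- h) x \<le> 1 - \<alpha> - 2 * \<mu>low * h"
      using AE_regular
    proof eventually_elim
      case (elim x)
      then show ?case
        using regular_conditional_law.coverage_decay[of "K x" \<alpha> \<mu>low \<mu>up r0 "q1 x" "q2 x" h] that
        by (simp add: cov0_def r_minus_def)
    qed
  qed
  \<comment> \<open>Inflations at which \<open>G\<close> has moved far enough from 1 - \<alpha> to
    absorb the errors. The excess \<open>s\<close> counts only above: \<open>H\<close> has to reach
    1 - \<alpha> + s at \<open>t0\<close>, but merely stay below that level at
    \<open>- t1\<close>.\<close>
  define t0 where "t0 = (2 * \<mu>up * \<epsilon> + \<eta> + s) / (2 * \<mu>low)"
  define t1 where "t1 = (2 * \<mu>up * \<epsilon> + \<eta>) / (2 * \<mu>low)"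
  have nonneg: "0 \<le> 2 * \<mu>up * \<epsilon> + \<eta>" using constants_pos \<epsilon>(1) \<eta> by simp
  have t0: "0 \<le> t0" "t0 \<le> r0" "2 * \<mu>low * t0 = 2 * \<mu>up * \<epsilon> + \<eta> + s"
    and t1: "0 \<le> t1" "t1 \<le> r_minus \<alpha> \<mu>up r0" "2 * \<mu>low * t1 = 2 * \<mu>up * \<epsilon> + \<eta>" and "t1 \<le> t0"
    using constants_pos nonneg s small
    by (auto simp: t0_def t1_def r_plus_def divide_le_eq mult_ac divide_right_mono)
  define T where "T = gen_inverse (1 - \<alpha> + s) H"
  have "1 - \<alpha> + s \<le> H t0"
    using H(2)[of t0] FG[of t0] grow[OF t0(1,2)] t0(3) by linarith
  then have "T \<le> ereal t0" unfolding T_def gen_inverse_def by (auto intro: Inf_lower)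
  \<comment> \<open>Strict because \<open>s\<close> is positive; by monotonicity no inflation below
    \<open>- t1\<close> reaches the level.\<close>
  have "H (- t1) < 1 - \<alpha> + s"
    using H(2)[of "- t1"] FG[of "- t1"] decay[OF t1(1,2)] t1(3) s by linarith
  then have "- t1 \<le> t" if "1 - \<alpha> + s \<le> H t" for t
    using that monoD[OF H(1), of t "- t1"] by linarith
  then have "ereal (- t1) \<le> T" unfolding T_def gen_inverse_def by (auto intro!: Inf_greatest)
  \<comment> \<open>Bounded on both sides, the threshold is real; the value \<infinity> of an
    unreached level is excluded.\<close>
  then obtain \<theta> where \<theta>: "T = ereal \<theta>" "\<bar>\<theta>\<bar> \<le> t0"
    using \<open>T \<le> ereal t0\<close> \<open>t1 \<le> t0\<close> by (cases T) auto
  have cov_eq: "measure (K x) {y. ereal (S (x, y)) \<le> T} = cov \<theta> x" for x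
    unfolding \<theta> S' cov_def by (intro arg_cong[of _ _ "measure _"]) (auto simp: interval_score_le_iff)
  have "AE x in PX. \<bar>cov \<theta> x - (1 - \<alpha>)\<bar> \<le> \<bar>\<mu>up * d x\<bar> + \<bar>2 * \<mu>up * t0\<bar>"
    using AE_regular close[of \<theta>]
  proof eventually_elim
    case (elim x)
    interpret R: regular_conditional_law "K x" \<alpha> \<mu>low \<mu>up r0 "q1 x" "q2 x" by fact
    have "\<bar>cov0 \<theta> x - (1 - \<alpha>)\<bar> \<le> 2 * \<mu>up * \<bar>\<theta>\<bar>" unfolding cov0_def by (rule R.coverage_inflation)
    also have "\<dots> \<le> 2 * \<mu>up * t0" using \<theta> constants_pos by (intro mult_left_mono) auto
    finally show ?case using elim(2) by linarith
  qed
  then have "Lp_norm p PX (\<lambda>x. cov \<theta> x - (1 - \<alpha>)) \<le> ennreal (\<mu>up * (\<epsilon> + \<epsilon>) + 2 * \<mu>up * t0)"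
    by (rule Lp_norm_add_le[OF p, rotated 7])
       (use p \<epsilon>(1) d constants_pos t0(1) in \<open>auto intro!: Lp_norm_cmult_le X.Lp_norm_const_le simp del: ennreal_plus\<close>)
  also have "\<mu>up * (\<epsilon> + \<epsilon>) + 2 * \<mu>up * t0 = 2 * \<mu>up * (1 + \<mu>up / \<mu>low) * \<epsilon> + \<mu>up / \<mu>low * (\<eta> + s)"
    using constants_pos by (simp add: t0_def field_simps)
  finally show ?thesis unfolding cov_eq[symmetric] T_def .
qed

end

section \<open>Measurability and the probability of the events\<close>

text \<open>For \<open>p = \<top>\<close> the event says that the section at \<open>D\<close> of the
  set where |g| exceeds \<open>c\<close> is null, and section measures are measurable in
  \<open>D\<close>. For finite \<open>p\<close> the norm itself is measurable in
  \<open>D\<close>.\<close>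

lemma measurable_Lp_norm_le:
  assumes "sigma_finite_measure M" and g [measurable]: "(\<lambda>(D, x). g D x) \<in> borel_measurable (N \<Otimes>\<^sub>M M)" and c: "0 \<le> c"
  shows "{D \<in> space N. Lp_norm p M (g D) \<le> ennreal c} \<in> sets N"
proof (cases "p = \<top>")
  case True
  interpret sigma_finite_measure M by fact
  have "{D \<in> space N. Lp_norm p M (g D) \<le> ennreal c}
      = {D \<in> space N. emeasure M (Pair D -` {z \<in> space (N \<Otimes>\<^sub>M M). c < \<bar>case z of (D, x) \<Rightarrow> g D x\<bar>}) = 0}"
  proof (intro Collect_cong conj_cong refl)
    fix D assume D: "D \<in> space N"
    then have [measurable]: "g D \<in> borel_measurable M" using measurable_Pair2[OF g D] by simp
    have "Pair D -` {z \<in> space (N \<Otimes>\<^sub>M M). c < \<bar>case z of (D, x) \<Rightarrow> g D x\<bar>} = {x \<in> space M. \<not> \<bar>g D x\<bar> \<le> c}"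
      using D by (auto simp: space_pair_measure)
    moreover have "(AE x in M. \<bar>g D x\<bar> \<le> c) \<longleftrightarrow> emeasure M {x \<in> space M. \<not> \<bar>g D x\<bar> \<le> c} = 0"
      by (rule AE_iff_measurable) auto
    ultimately show "Lp_norm p M (g D) \<le> ennreal c \<longleftrightarrow>
        emeasure M (Pair D -` {z \<in> space (N \<Otimes>\<^sub>M M). c < \<bar>case z of (D, x) \<Rightarrow> g D x\<bar>}) = 0"
      using True c by (simp add: Lp_norm_top_le_iff)
  qed
  moreover have "(\<lambda>D. emeasure M (Pair D -` {z \<in> space (N \<Otimes>\<^sub>M M). c < \<bar>case z of (D, x) \<Rightarrow> g D x\<bar>})) \<in> borel_measurable N"
    by (rule measurable_emeasure_Pair) measurable
  ultimately show ?thesis by simp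
next
  case False
  interpret sigma_finite_measure M by fact
  have "(\<lambda>D. \<integral>\<^sup>+ x. ennreal (\<bar>g D x\<bar> powr enn2real p) \<partial>M) \<in> borel_measurable N"
    by (rule borel_measurable_nn_integral) measurable
  then have "(\<lambda>D. Lp_norm p M (g D)) \<in> borel_measurable N"
    using False unfolding Lp_norm_def Let_def by simp
  then show ?thesis by simp
qed

text \<open>By right continuity a violation at \<open>t\<close> persists on an interval to its
  right, which contains a rational. The bound \<open>B\<close> makes the real supremum the true
  one.\<close>

lemma SUP_abs_le_iff_rat:
  fixes G :: "real \<Rightarrow> real"
  assumes right: "\<And>t. (G \<longlongrightarrow> G t) (at_right t)" and bdd: "\<And>t. \<bar>G t\<bar> \<le> B"
  shows "(SUP t. \<bar>G t\<bar>) \<le> c \<longleftrightarrow> (\<forall>q::rat. \<bar>G (of_rat q)\<bar> \<le> c)"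
proof -
  have "(SUP t. \<bar>G t\<bar>) \<le> c \<longleftrightarrow> (\<forall>t. \<bar>G t\<bar> \<le> c)"
    using bdd by (subst cSUP_le_iff) (auto intro!: bdd_aboveI[of _ B])
  also have "\<dots> \<longleftrightarrow> (\<forall>q::rat. \<bar>G (of_rat q)\<bar> \<le> c)"
  proof (intro iffI allI)
    fix t assume rat: "\<forall>q::rat. \<bar>G (of_rat q)\<bar> \<le> c"
    show "\<bar>G t\<bar> \<le> c"
    proof (rule ccontr)
      assume "\<not> \<bar>G t\<bar> \<le> c"
      then have "eventually (\<lambda>s. c < \<bar>G s\<bar>) (at_right t)"
        using order_tendstoD(1)[OF tendsto_rabs[OF right[of t]]] by simp
      then obtain b where b: "t < b" "\<And>s. t < s \<Longrightarrow> s < b \<Longrightarrow> c < \<bar>G s\<bar>"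
        unfolding eventually_at_right_field by blast
      obtain q where "t < of_rat q" "of_rat q < b" using of_rat_dense[OF b(1)] by blast
      then have "c < \<bar>G (of_rat q)\<bar>" by (rule b(2))
      then show False using rat[rule_format, of q] by linarith
    qed
  qed auto
  finally show ?thesis .
qed

lemma empirical_cdf_nonneg: "0 \<le> empirical_cdf m D S t"
  by (simp add: empirical_cdf_eq)

lemma empirical_cdf_le_1: "empirical_cdf m D S t \<le> 1"
proof -
  have "{i \<in> {1..m}. S (D i) \<le> t} \<subseteq> {1..m}" by auto
  then have "card {i \<in> {1..m}. S (D i) \<le> t} \<le> m"
    using card_mono[OF finite_atLeastAtMost, of _ 1 m] by simp
  then show ?thesis by (cases "m = 0") (auto simp: empirical_cdf_eq divide_le_eq)
qed

lemma empirical_cdf_mono: "mono (empirical_cdf m D S)"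
  unfolding mono_def empirical_cdf_def by (intro allI impI mult_left_mono sum_mono) auto

lemma empirical_cdf_right_cont: "(empirical_cdf m D S \<longlongrightarrow> empirical_cdf m D S t) (at_right t)"
proof -
  have step: "((\<lambda>t'. of_bool (s \<le> t')) \<longlongrightarrow> (of_bool (s \<le> t) :: real)) (at_right t)" for s
  proof (rule tendsto_eventually)
    show "eventually (\<lambda>t'. of_bool (s \<le> t') = (of_bool (s \<le> t) :: real)) (at_right t)"
    proof (cases "s \<le> t")
      case True
      then show ?thesis by (auto simp: eventually_at_right_field intro!: exI[of _ "t + 1"])
    next
      case False
      then show ?thesis by (auto simp: eventually_at_right_field intro!: exI[of _ s])
    qed
  qed
  show ?thesis unfolding empirical_cdf_def by (intro tendsto_intros step)
qed

lemma distribution_right_cont: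
  fixes S :: "'z \<Rightarrow> real"
  assumes "prob_space N" and [measurable]: "S \<in> borel_measurable N"
  shows "((\<lambda>t. measure N {z \<in> space N. S z \<le> t}) \<longlongrightarrow> measure N {z \<in> space N. S z \<le> t}) (at_right t)"
proof -
  interpret N: prob_space N by fact
  interpret L: real_distribution "distr N borel S" by (rule N.real_distribution_distr) simp
  have F: "measure N {z \<in> space N. S z \<le> t} = cdf (distr N borel S) t" for t
    by (simp add: cdf_def measure_distr vimage_def Int_def conj_commute)
  show ?thesis unfolding F using L.cdf_is_right_cont[of t] by (simp add: continuous_within)
qed

context regular_model
begin

lemma prob_space_sample_law: "prob_space (sample_law PX K n)"
  unfolding sample_law_def by (intro prob_space_PiM prob_space_joint_law)

lemma measurable_sample_component [measurable]:
  "i \<in> {1..m} \<Longrightarrow> (\<lambda>D. D i) \<in> sample_law PX K m \<rightarrow>\<^sub>M PX \<Otimes>\<^sub>M borel"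
  unfolding sample_law_def
  using measurable_component_singleton[of i "{1..m}" "\<lambda>_. joint_law PX K"]
  by (simp add: measurable_cong_sets[OF refl sets_joint_law])

end

section \<open>Joint measurability and the DKW event in the two samples\<close>

locale split_cqr = regular_model PX K \<alpha> \<mu>low \<mu>up r0
  for PX :: "'a measure" and K \<alpha> \<mu>low \<mu>up r0 +
  fixes f :: "'a training" and n :: nat
  assumes n: "1 \<le> n" and raw: "raw_maps_measurable PX K \<alpha> f"
begin

abbreviation "lo D \<equiv> lower_endpoint \<alpha> f n D"
abbreviation "hi D \<equiv> upper_endpoint \<alpha> f n D"
abbreviation "S D \<equiv> fitted_score \<alpha> f n D"
abbreviation "Tr \<equiv> sample_law PX K n"

lemma raw_measurable [measurable]:
  "(\<lambda>(D, x). f n (\<alpha> / 2) D x) \<in> borel_measurable (Tr \<Otimes>\<^sub>M PX)"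
  "(\<lambda>(D, x). f n (1 - \<alpha> / 2) D x) \<in> borel_measurable (Tr \<Otimes>\<^sub>M PX)"
  using raw n unfolding raw_maps_measurable_def by auto

lemma endpoints_measurable [measurable]:
  "(\<lambda>(D, x). lo D x) \<in> borel_measurable (Tr \<Otimes>\<^sub>M PX)"
  "(\<lambda>(D, x). hi D x) \<in> borel_measurable (Tr \<Otimes>\<^sub>M PX)"
  unfolding lower_endpoint_def upper_endpoint_def by measurable

lemma raw_section_measurable:
  assumes "D \<in> space Tr"
  shows "f n (\<alpha> / 2) D \<in> borel_measurable PX" "f n (1 - \<alpha> / 2) D \<in> borel_measurable PX"
  using measurable_Pair2[OF raw_measurable(1) assms] measurable_Pair2[OF raw_measurable(2) assms] by simp_all

lemma endpoint_section_measurable: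
  assumes "D \<in> space Tr"
  shows "lo D \<in> borel_measurable PX" "hi D \<in> borel_measurable PX"
  using measurable_Pair2[OF endpoints_measurable(1) assms] measurable_Pair2[OF endpoints_measurable(2) assms]
  by simp_all

lemma fitted_score_eq: "S D = interval_score (lo D) (hi D)"
  by (simp add: fitted_score_def interval_score_def)

lemma fitted_score_measurable:
  assumes "D \<in> space Tr"
  shows "S D \<in> borel_measurable (joint_law PX K)"
  unfolding fitted_score_eq measurable_cong_sets[OF sets_joint_law refl]
  using endpoint_section_measurable[OF assms] by (rule interval_score_measurable)

text \<open>The DKW event as a relation between two samples, so that its probability can be computed
  with the training sample frozen.\<close>

definition gap_ok :: "nat \<Rightarrow> real \<Rightarrow> (nat \<Rightarrow> 'a \<times> real) \<Rightarrow> (nat \<Rightarrow> 'a \<times> real) \<Rightarrow> bool" where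
  "gap_ok m \<eta> D D' \<longleftrightarrow> (SUP t. \<bar>empirical_cdf m D' (S D) t - score_cdf PX K (S D) t\<bar>) \<le> \<eta>"

lemma score_cdf_bounds: "0 \<le> score_cdf PX K s t" "score_cdf PX K s t \<le> 1"
  unfolding score_cdf_def using prob_space_joint_law by (auto simp: prob_space.prob_le_1)

lemma gap_le_1: "\<bar>empirical_cdf m D' (S D) t - score_cdf PX K (S D) t\<bar> \<le> 1"
  using score_cdf_bounds[of "S D" t] empirical_cdf_nonneg[of m D' "S D" t] empirical_cdf_le_1[of m D' "S D" t]
  by linarith

lemma gap_ok_iff: "gap_ok m \<eta> D D' \<longleftrightarrow> (\<forall>t. \<bar>empirical_cdf m D' (S D) t - score_cdf PX K (S D) t\<bar> \<le> \<eta>)"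
  unfolding gap_ok_def using gap_le_1
  by (subst cSUP_le_iff) (auto intro!: bdd_aboveI[of _ 1])

lemma gap_ok_iff_rat:
  assumes "D \<in> space Tr"
  shows "gap_ok m \<eta> D D' \<longleftrightarrow>
    (\<forall>q::rat. \<bar>empirical_cdf m D' (S D) (of_rat q) - score_cdf PX K (S D) (of_rat q)\<bar> \<le> \<eta>)"
  unfolding gap_ok_def
proof (rule SUP_abs_le_iff_rat)
  fix t
  show "((\<lambda>t. empirical_cdf m D' (S D) t - score_cdf PX K (S D) t)
      \<longlongrightarrow> empirical_cdf m D' (S D) t - score_cdf PX K (S D) t) (at_right t)"
    unfolding score_cdf_def
    by (intro tendsto_diff empirical_cdf_right_cont distribution_right_cont prob_space_joint_law
        fitted_score_measurable assms)
qed (rule gap_le_1)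

text \<open>The score CDF averages over \<open>x\<close> a coverage that is jointly measurable in
  the training sample and \<open>x\<close>.\<close>

lemma score_cdf_measurable [measurable]: "(\<lambda>D. score_cdf PX K (S D) t) \<in> borel_measurable Tr"
proof -
  have 1: "(\<lambda>z. K (snd z)) \<in> Tr \<Otimes>\<^sub>M PX \<rightarrow>\<^sub>M prob_algebra borel" by measurable
  have 2: "(\<lambda>z. lo (fst z) (snd z) - t) \<in> borel_measurable (Tr \<Otimes>\<^sub>M PX)"
       "(\<lambda>z. hi (fst z) (snd z) + t) \<in> borel_measurable (Tr \<Otimes>\<^sub>M PX)"
    using endpoints_measurable by (simp_all add: case_prod_beta')
  have "(\<lambda>z. measure (K (snd z)) {lo (fst z) (snd z) - t..hi (fst z) (snd z) + t}) \<in> borel_measurable (Tr \<Otimes>\<^sub>M PX)"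
    by (rule measurable_coverage[OF 1 2])
  then have "(\<lambda>D. \<integral> x. measure (K x) {lo D x - t..hi D x + t} \<partial>PX) \<in> borel_measurable Tr"
    by (intro X.borel_measurable_lebesgue_integral) (simp add: case_prod_beta')
  then show ?thesis
    by (rule measurable_cong[THEN iffD1, rotated])
       (simp add: fitted_score_eq score_cdf_eq endpoint_section_measurable)
qed

lemma empirical_cdf_measurable:
  "(\<lambda>(D, D'). empirical_cdf m D' (S D) t) \<in> borel_measurable (Tr \<Otimes>\<^sub>M sample_law PX K m)"
proof -
  have "(\<lambda>z. of_bool (S (fst z) (snd z i) \<le> t)) \<in> borel_measurable (Tr \<Otimes>\<^sub>M sample_law PX K m)" if i: "i \<in> {1..m}" for i
  proof -
    note [measurable] = measurable_sample_component[OF i]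
    have xy: "(\<lambda>z. snd z i) \<in> Tr \<Otimes>\<^sub>M sample_law PX K m \<rightarrow>\<^sub>M PX \<Otimes>\<^sub>M borel" by measurable
    \<comment> \<open>The training sample selects the fitted map and the calibration point its
      argument, so the composition rests on joint measurability.\<close>
    have Dx: "(\<lambda>z. (fst z, fst (snd z i))) \<in> Tr \<Otimes>\<^sub>M sample_law PX K m \<rightarrow>\<^sub>M Tr \<Otimes>\<^sub>M PX"
      using xy by measurable
    have [measurable]: "(\<lambda>z. lo (fst z) (fst (snd z i))) \<in> borel_measurable (Tr \<Otimes>\<^sub>M sample_law PX K m)"
      "(\<lambda>z. hi (fst z) (fst (snd z i))) \<in> borel_measurable (Tr \<Otimes>\<^sub>M sample_law PX K m)"
      using measurable_compose[OF Dx endpoints_measurable(1)] measurable_compose[OF Dx endpoints_measurable(2)]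
      by simp_all
    have [measurable]: "(\<lambda>z. snd (snd z i)) \<in> borel_measurable (Tr \<Otimes>\<^sub>M sample_law PX K m)"
      using xy by measurable
    show ?thesis unfolding fitted_score_def case_prod_beta' by measurable
  qed
  then show ?thesis unfolding empirical_cdf_def case_prod_beta' by measurable
qed

lemma gap_ok_measurable:
  "{z \<in> space (Tr \<Otimes>\<^sub>M sample_law PX K m). gap_ok m \<eta> (fst z) (snd z)} \<in> sets (Tr \<Otimes>\<^sub>M sample_law PX K m)"
proof -
  note [measurable] = empirical_cdf_measurable[unfolded case_prod_beta']
  have "{z \<in> space (Tr \<Otimes>\<^sub>M sample_law PX K m). gap_ok m \<eta> (fst z) (snd z)}
    = {z \<in> space (Tr \<Otimes>\<^sub>M sample_law PX K m). \<forall>q::rat.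
        \<bar>empirical_cdf m (snd z) (S (fst z)) (of_rat q) - score_cdf PX K (S (fst z)) (of_rat q)\<bar> \<le> \<eta>}"
    by (auto simp: space_pair_measure gap_ok_iff_rat)
  also have "\<dots> \<in> sets (Tr \<Otimes>\<^sub>M sample_law PX K m)" by measurable
  finally show ?thesis .
qed

lemma gap_not_ok_prob:
  assumes m: "1 \<le> m" and \<eta>: "0 < \<eta>" and D: "D \<in> space Tr"
  shows "measure (sample_law PX K m) {D' \<in> space (sample_law PX K m). \<not> gap_ok m \<eta> D D'} \<le> 2 * exp (- 2 * real m * \<eta>\<^sup>2)"
proof -
  have "measure (joint_law PX K) {z \<in> space (joint_law PX K). S D z = t} = 0" for t
    unfolding fitted_score_eq using endpoint_section_measurable[OF D] by (rule score_atomless)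
  then obtain E where E: "E \<in> sets (sample_law PX K m)" "measure (sample_law PX K m) E \<le> 2 * exp (- 2 * real m * \<eta>\<^sup>2)"
    "\<And>D' t. D' \<in> space (sample_law PX K m) \<Longrightarrow>
      \<eta> < \<bar>empirical_cdf m D' (S D) t - score_cdf PX K (S D) t\<bar> \<Longrightarrow> D' \<in> E"
    unfolding sample_law_def score_cdf_def
    using dkw_massart[OF prob_space_joint_law m \<eta> fitted_score_measurable[OF D]] by blast
  interpret P: prob_space "sample_law PX K m" by (rule prob_space_sample_law)
  have "{D' \<in> space (sample_law PX K m). \<not> gap_ok m \<eta> D D'} \<subseteq> E"
    using E(3) by (auto simp: gap_ok_iff not_le)
  then show ?thesis using P.finite_measure_mono[OF _ E(1)] E(2) by (meson order_trans)
qed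

text \<open>The bound for a frozen training sample is the same for all samples, so integrating over
  the training law preserves it.\<close>

lemma gap_not_ok_prob_joint:
  assumes m: "1 \<le> m" and \<eta>: "0 < \<eta>"
  shows "measure (Tr \<Otimes>\<^sub>M sample_law PX K m)
    {z \<in> space (Tr \<Otimes>\<^sub>M sample_law PX K m). \<not> gap_ok m \<eta> (fst z) (snd z)} \<le> 2 * exp (- 2 * real m * \<eta>\<^sup>2)"
proof -
  let ?C = "sample_law PX K m"
  let ?X = "{z \<in> space (Tr \<Otimes>\<^sub>M ?C). \<not> gap_ok m \<eta> (fst z) (snd z)}"
  interpret T: prob_space Tr by (rule prob_space_sample_law)
  interpret C: prob_space ?C by (rule prob_space_sample_law)
  interpret TC: pair_prob_space Tr ?C ..
  have X: "?X \<in> sets (Tr \<Otimes>\<^sub>M ?C)" using sets.sets_Collect_neg[OF gap_ok_measurable] .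
  have "emeasure (Tr \<Otimes>\<^sub>M ?C) ?X = (\<integral>\<^sup>+ D. emeasure ?C (Pair D -` ?X) \<partial>Tr)"
    by (rule C.emeasure_pair_measure_alt[OF X])
  also have "\<dots> \<le> (\<integral>\<^sup>+ D. ennreal (2 * exp (- 2 * real m * \<eta>\<^sup>2)) \<partial>Tr)"
  proof (rule nn_integral_mono)
    fix D assume D: "D \<in> space Tr"
    have "Pair D -` ?X = {D' \<in> space ?C. \<not> gap_ok m \<eta> D D'}" using D by (auto simp: space_pair_measure)
    then show "emeasure ?C (Pair D -` ?X) \<le> ennreal (2 * exp (- 2 * real m * \<eta>\<^sup>2))"
      using gap_not_ok_prob[OF m \<eta> D] by (simp add: C.emeasure_eq_measure)
  qed
  also have "\<dots> = ennreal (2 * exp (- 2 * real m * \<eta>\<^sup>2))" by (simp add: T.emeasure_space_1)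
  finally show ?thesis by (simp add: TC.emeasure_eq_measure)
qed

end

section \<open>The level, the radius and the union bound\<close>

lemma level_excess_pos:
  assumes "\<alpha> < 1" "1 \<le> m"
  shows "0 < level_excess \<alpha> m"
proof -
  have m: "0 < real m" using assms by simp
  have "(real m + 1) * (1 - \<alpha>) \<le> of_int \<lceil>(real m + 1) * (1 - \<alpha>)\<rceil>" by (rule le_of_int_ceiling)
  \<comment> \<open>The \<open>m + 1\<close> inside the ceiling makes the excess strictly positive
    however the rounding falls.\<close>
  moreover have "(1 - \<alpha>) * real m < (real m + 1) * (1 - \<alpha>)"
    using assms(1) by (simp add: distrib_right mult.commute)
  ultimately have "(1 - \<alpha>) * real m < of_int \<lceil>(real m + 1) * (1 - \<alpha>)\<rceil>" by linarith
  then show ?thesis using m by (simp add: level_excess_def conf_level_def less_divide_eq)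
qed

lemma dkw_radius_pos:
  assumes "0 < \<delta>" "\<delta> < 1" "1 \<le> m"
  shows "0 < dkw_radius m \<delta>" "2 * exp (- 2 * real m * (dkw_radius m \<delta>)\<^sup>2) = \<delta> / 2"
proof -
  have l: "0 < ln (4 / \<delta>)" using assms by (simp add: ln_gt_zero)
  then show "0 < dkw_radius m \<delta>" using assms by (simp add: dkw_radius_def)
  have "(dkw_radius m \<delta>)\<^sup>2 = ln (4 / \<delta>) / (2 * real m)"
    using l assms by (simp add: dkw_radius_def)
  then have "- 2 * real m * (dkw_radius m \<delta>)\<^sup>2 = - ln (4 / \<delta>)" using assms by simp
  then show "2 * exp (- 2 * real m * (dkw_radius m \<delta>)\<^sup>2) = \<delta> / 2"
    using assms by (simp add: exp_minus)
qed

theorem theorem2: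
  fixes PX :: "'a measure" and K :: "'a \<Rightarrow> real measure"
    and M :: "'w measure" and Dtr Dcal :: "'w \<Rightarrow> nat \<Rightarrow> 'a \<times> real"
    and f :: "'a training" and \<epsilon> :: "nat \<Rightarrow> real \<Rightarrow> real"
    and p :: ennreal and \<alpha> \<delta> \<mu>low \<mu>up r0 :: real and n m :: nat
  assumes "0 < \<alpha>" and "\<alpha> < 1" and "1 \<le> p"
    and "prob_space PX"
    and "K \<in> PX \<rightarrow>\<^sub>M prob_algebra borel"
    and "mass_regularity PX K \<alpha> \<mu>low \<mu>up r0"
    and "raw_maps_measurable PX K \<alpha> f"
    and "endpoint_accuracy PX K \<alpha> p f \<epsilon>"
    and "0 < \<delta>" and "\<delta> < 1" and "1 \<le> n" and "1 \<le> m"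
    and "prob_space M"
    and "prob_space.indep_var M (sample_law PX K n) Dtr (sample_law PX K m) Dcal"
    and "distr M (sample_law PX K n) Dtr = sample_law PX K n"
    and "distr M (sample_law PX K m) Dcal = sample_law PX K m"
    and "2 * \<mu>up * \<epsilon> n (\<delta>/4) + dkw_radius m \<delta> \<le> 2 * \<mu>low * r_minus \<alpha> \<mu>up r0"
    and "2 * \<mu>up * \<epsilon> n (\<delta>/4) + dkw_radius m \<delta> + level_excess \<alpha> m \<le> 2 * \<mu>low * r_plus r0"
  defines "A \<equiv> training_event M PX K \<alpha> p f \<epsilon> n \<delta> Dtr \<inter> dkw_event M PX K \<alpha> f n m \<delta> Dtr Dcal"
  shows "A \<in> sets M \<and> measure M A \<ge> 1 - \<delta> \<and>
    (\<forall>\<omega>\<in>A.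
      Lp_norm p PX (\<lambda>x. cond_coverage K (cqr_set \<alpha> f n m (Dtr \<omega>) (Dcal \<omega>)) x - (1 - \<alpha>))
        \<le> ennreal (2 * \<mu>up * (1 + \<mu>up / \<mu>low) * \<epsilon> n (\<delta>/4)
                   + \<mu>up / \<mu>low * (dkw_radius m \<delta> + level_excess \<alpha> m)))"
proof -
  interpret X: prob_space PX by fact
  interpret split_cqr PX K \<alpha> \<mu>low \<mu>up r0 f n
    by unfold_locales fact+
  interpret M: prob_space M by fact
  let ?C = "sample_law PX K m"
  let ?\<eta> = "dkw_radius m \<delta>"
  have \<epsilon>: "0 \<le> \<epsilon> n (\<delta> / 4)" and acc: "\<And>\<tau>. \<tau> \<in> {\<alpha>/2, 1 - \<alpha>/2} \<Longrightarrow>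
      measure Tr {D \<in> space Tr. Lp_norm p PX (\<lambda>x. f n \<tau> D x - cond_quantile K \<tau> x) \<le> ennreal (\<epsilon> n (\<delta> / 4))} \<ge> 1 - \<delta> / 4"
    using assms(8)[unfolded endpoint_accuracy_def, rule_format, of n "\<delta> / 4"] assms(9-11) by auto
  \<comment> \<open>Independence and the two marginals identify the joint law of the samples as the
    product law.\<close>
  have rv [measurable]: "Dtr \<in> M \<rightarrow>\<^sub>M Tr" "Dcal \<in> M \<rightarrow>\<^sub>M ?C"
    and pair: "distr M (Tr \<Otimes>\<^sub>M ?C) (\<lambda>\<omega>. (Dtr \<omega>, Dcal \<omega>)) = Tr \<Otimes>\<^sub>M ?C"
    using assms(14) unfolding M.indep_var_distribution_eq by (auto simp: assms(15,16))
  define good where "good \<tau> = {D \<in> space Tr. Lp_norm p PX (\<lambda>x. f n \<tau> D x - cond_quantile K \<tau> x) \<le> ennreal (\<epsilon> n (\<delta> / 4))}" for \<tau>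
  have good [measurable]: "good (\<alpha> / 2) \<in> sets Tr" "good (1 - \<alpha> / 2) \<in> sets Tr"
    unfolding good_def using X.sigma_finite_measure_axioms \<epsilon>
    by (intro measurable_Lp_norm_le; measurable)+
  define Etr where "Etr \<tau> = {\<omega> \<in> space M. Dtr \<omega> \<notin> good \<tau>}" for \<tau>
  have Etr: "Etr \<tau> \<in> sets M \<and> measure M (Etr \<tau>) \<le> \<delta> / 4" if \<tau>: "\<tau> \<in> {\<alpha>/2, 1 - \<alpha>/2}" for \<tau>
  proof -
    have g: "good \<tau> \<in> sets Tr" using good \<tau> by blast
    note [measurable] = g
    have "measure M {\<omega> \<in> space M. Dtr \<omega> \<in> good \<tau>} = measure (distr M Tr Dtr) (good \<tau>)"
      by (simp add: measure_distr g vimage_def Int_def conj_commute)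
    also have "\<dots> \<ge> 1 - \<delta> / 4" unfolding assms(15) good_def by (rule acc[OF \<tau>])
    finally show ?thesis
      unfolding Etr_def using M.prob_neg[of "\<lambda>\<omega>. Dtr \<omega> \<in> good \<tau>"] by simp
  qed
  let ?bad = "{z \<in> space (Tr \<Otimes>\<^sub>M ?C). \<not> gap_ok m ?\<eta> (fst z) (snd z)}"
  have bad [measurable]: "?bad \<in> sets (Tr \<Otimes>\<^sub>M ?C)" using sets.sets_Collect_neg[OF gap_ok_measurable] .
  define Edkw where "Edkw = {\<omega> \<in> space M. \<not> gap_ok m ?\<eta> (Dtr \<omega>) (Dcal \<omega>)}"
  have Edkw_eq: "Edkw = (\<lambda>\<omega>. (Dtr \<omega>, Dcal \<omega>)) -` ?bad \<inter> space M"
    using measurable_space[OF rv(1)] measurable_space[OF rv(2)] by (auto simp: Edkw_def space_pair_measure)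
  have pair_rv: "(\<lambda>\<omega>. (Dtr \<omega>, Dcal \<omega>)) \<in> M \<rightarrow>\<^sub>M Tr \<Otimes>\<^sub>M ?C" by measurable
  have Edkw: "Edkw \<in> sets M" unfolding Edkw_eq by (rule measurable_sets[OF pair_rv bad])
  have "measure M Edkw = measure (Tr \<Otimes>\<^sub>M ?C) ?bad"
    unfolding Edkw_eq by (subst measure_distr[OF pair_rv bad, symmetric]) (simp only: pair)
  also have "\<dots> \<le> \<delta> / 2"
    using gap_not_ok_prob_joint[OF \<open>1 \<le> m\<close> dkw_radius_pos(1)[OF assms(9,10,12)]]
    unfolding dkw_radius_pos(2)[OF assms(9,10,12)] .
  finally have Edkw_prob: "measure M Edkw \<le> \<delta> / 2" .
  have Etr1: "Etr (\<alpha> / 2) \<in> sets M" "measure M (Etr (\<alpha> / 2)) \<le> \<delta> / 4"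
    and Etr2: "Etr (1 - \<alpha> / 2) \<in> sets M" "measure M (Etr (1 - \<alpha> / 2)) \<le> \<delta> / 4"
    using Etr by blast+
  \<comment> \<open>The failures of the two endpoints and of the DKW bound cost \<delta>/4,
    \<delta>/4 and \<delta>/2.\<close>
  let ?N = "Etr (\<alpha> / 2) \<union> Etr (1 - \<alpha> / 2) \<union> Edkw"
  have N: "?N \<in> sets M" using Etr1(1) Etr2(1) Edkw by (intro sets.Un)
  have "measure M ?N \<le> measure M (Etr (\<alpha> / 2)) + measure M (Etr (1 - \<alpha> / 2)) + measure M Edkw"
    using measure_Un_le[of "Etr (\<alpha> / 2) \<union> Etr (1 - \<alpha> / 2)" M Edkw]
      measure_Un_le[OF Etr1(1) Etr2(1)] sets.Un[OF Etr1(1) Etr2(1)] Edkw by linarith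
  also have "\<dots> \<le> \<delta>" using Etr1(2) Etr2(2) Edkw_prob by linarith
  finally have N_prob: "measure M ?N \<le> \<delta>" .
  \<comment> \<open>Being exactly the complement of the three failures, the event is measurable and
    inherits its probability from the union bound.\<close>
  have A: "A = space M - ?N"
    using measurable_space[OF rv(1)]
    unfolding A_def training_event_def dkw_event_def Etr_def Edkw_def good_def gap_ok_def by auto
  have "Lp_norm p PX (\<lambda>x. cond_coverage K (cqr_set \<alpha> f n m (Dtr \<omega>) (Dcal \<omega>)) x - (1 - \<alpha>))
        \<le> ennreal (2 * \<mu>up * (1 + \<mu>up / \<mu>low) * \<epsilon> n (\<delta>/4)
                   + \<mu>up / \<mu>low * (?\<eta> + level_excess \<alpha> m))" if \<omega>: "\<omega> \<in> A" for \<omega>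
  proof -
    have D: "Dtr \<omega> \<in> space Tr" using \<omega> A measurable_space[OF rv(1)] by auto
    have L: "Lp_norm p PX (\<lambda>x. f n (\<alpha> / 2) (Dtr \<omega>) x - q1 x) \<le> ennreal (\<epsilon> n (\<delta> / 4))"
        "Lp_norm p PX (\<lambda>x. f n (1 - \<alpha> / 2) (Dtr \<omega>) x - q2 x) \<le> ennreal (\<epsilon> n (\<delta> / 4))"
      using \<omega> unfolding A_def training_event_def by auto
    have gap: "\<bar>empirical_cdf m (Dcal \<omega>) (S (Dtr \<omega>)) t - score_cdf PX K (S (Dtr \<omega>)) t\<bar> \<le> ?\<eta>" for t
      using \<omega> A unfolding Edkw_def by (simp add: gap_ok_iff)
    have beta: "1 - \<alpha> + level_excess \<alpha> m = conf_level \<alpha> m" by (simp add: level_excess_def)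
    have S: "S (Dtr \<omega>) = interval_score (\<lambda>x. min (f n (\<alpha> / 2) (Dtr \<omega>) x) (f n (1 - \<alpha> / 2) (Dtr \<omega>) x))
        (\<lambda>x. max (f n (\<alpha> / 2) (Dtr \<omega>) x) (f n (1 - \<alpha> / 2) (Dtr \<omega>) x))"
      unfolding fitted_score_eq lower_endpoint_def upper_endpoint_def ..
    show ?thesis
      unfolding cond_coverage_def cqr_set_def cqr_threshold_def beta [symmetric]
      by (rule Lp_norm_coverage_error_le[OF \<open>1 \<le> p\<close> raw_section_measurable[OF D] \<epsilon> L
            less_imp_le[OF dkw_radius_pos(1)[OF assms(9,10,12)]] level_excess_pos[OF assms(2,12)]
            assms(17,18) S empirical_cdf_mono gap])
  qed
  moreover have "A \<in> sets M" unfolding A using N by auto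
  moreover have "1 - \<delta> \<le> measure M A"
    unfolding A using M.prob_compl[OF N] N_prob by simp
  ultimately show ?thesis by blast
qed

end
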